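(* Let $0<q<1$. The locally compact quantum group $SU_q(1,1)_{\mathrm{ext}}$ is coamenable.
   Context: A locally compact quantum group $\mathbb{G}$ (Kustermans–Vaes) with left multiplicative unitary $W\in B(L^2(\mathbb{G})\otimes L^2(\mathbb{G}))$ has $L^\infty(\mathbb{G})$ equal to the $\sigma$-strong-$*$ closure of $\{(\mathrm{id}\otimes\omega)(W)\mid \omega\in B(L^2(\mathbb{G}))_*\}$, comultiplication $\Delta(x)=W^*(1\otimes x)W$, and $C_0(\mathbb{G})$ equal to the norm closure of the same set. $\mathbb{G}$ is coamenable if there is a state $\epsilon$ on $C_0(\mathbb{G})$ with $(\epsilon\otimes\mathrm{id})(W)=1$; equivalently, if there is a net of unit vectors $\xi_i\in L^2(\mathbb{G})$ with $(\omega_{\xi_i}\otimes\mathrm{id})(W)\to1$ $\sigma$-weakly, where $\omega_{\xi}(x)=\langle x\xi,\xi\rangle$; equivalently, if the convolution algebra $L^1(\mathbb{G})$ has a bounded approximate identity. Definition of $SU_q(1,1)_{\mathrm{ext}}$ (extended quantum $SU(1,1)$, Koelink–Kustermans). Let $\mathbb{N}=\{1,2,\dots\}$, $I_q=q^{\mathbb{Z}}\cup -q^{\mathbb{N}}$, and $L^2(\mathbb{G})=\ell^2(\mathbb{Z})\otimes\ell^2(I_q)\otimes\ell^2(I_q)$ with canonical orthonormal basis $f_{m,p,t}$, $m\in\mathbb{Z}$, $p,t\in I_q$. Write $(a;q^2)_k=\prod_{l=0}^{k-1}(1-aq^{2l})$ for $k\in\mathbb{N}\cup\{0,\infty\}$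 and $(a,b;q^2)_k=(a;q^2)_k(b;q^2)_k$. For $t\in\pm q^{\mathbb{Z}}$ let $\chi(t)=\log_q|t|$ and $\nu(t)=q^{\frac12(\chi(t)-1)(\chi(t)-2)}$; let $\kappa(x)=\mathrm{sgn}(x)x^2$ and $c_q=(\sqrt2\,q\,(q^2,-q^2;q^2)_\infty)^{-1}$. Let $s(x,y)=-1$ if $x>0$ and $y<0$, and $s(x,y)=1$ otherwise. Put $$\Psi(a;b;z)=\sum_{n=0}^\infty\frac{(a;q^2)_n\,(bq^{2n};q^2)_\infty}{(q^2;q^2)_n}(-1)^nq^{n(n-1)}z^n .$$ For $p,x,y\in I_q$ let $a_p(x,y)=0$ if $\mathrm{sgn}(xy)\ne\mathrm{sgn}(p)$, and otherwise $$a_p(x,y)=c_q\,s(x,y)\,(-1)^{\chi(p)}(-\mathrm{sgn}(y))^{\chi(x)}\,|y|\,\nu(py/x)\sqrt{\frac{(-\kappa(p),-\kappa(y);q^2)_\infty}{(-\kappa(x);q^2)_\infty}}\ \Psi\!\left(-\tfrac{q^2}{\kappa(y)};\,q^2\kappa(x/y);\,q^2\kappa(x/p)\right).$$ There is a unitary $W$ on $L^2(\mathbb{G})\otimes L^2(\mathbb{G})$ determined by $$W^*(f_{m_1,p_1,t_1}\otimes f_{m_2,p_2,t_2})=\sum_{y,z}\Big|\frac{t_2}{y}\Big|\,a_{t_2}(p_1,y)\,a_{p_2}(z,w_{y,z})\; f_{m_1+m_2-\chi(p_1p_2/(t_2z)),\,z,\,t_1}\otimes f_{\chi(p_1p_2/(t_2z)),\,w_{y,z},\,y},$$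 where $w_{y,z}=\mathrm{sgn}(p_2t_2)\frac{yz}{p_1}q^{m_2}$ and the sum runs over all $y,z\in I_q$ with $w_{y,z}\in I_q$. $SU_q(1,1)_{\mathrm{ext}}$ is the locally compact quantum group $\mathbb{G}$ with left multiplicative unitary $W$. *)

theory Defs
  imports "HOL-Analysis.Analysis"
begin

section \<open>The complex Hilbert space of square-summable families\<close>

typedef 'i ell2 = "{x :: 'i \<Rightarrow> complex. (\<lambda>i. (cmod (x i))\<^sup>2) summable_on UNIV}"
  morphisms coord Abs_ell2
  by (rule exI[of _ "\<lambda>_. 0"]) simp

setup_lifting type_definition_ell2

lemma square_summable_product:
  fixes x y :: "'i \<Rightarrow> complex"
  assumes "(\<lambda>i. (cmod (x i))\<^sup>2) summable_on UNIV" "(\<lambda>i. (cmod (y i))\<^sup>2) summable_on UNIV"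
  shows "(\<lambda>i. norm (x i * y i)) summable_on UNIV"
  by (rule Infinite_Sum.abs_summable_product) (use assms in \<open>simp_all add: norm_mult power2_eq_square\<close>)

lemma square_summable_add:
  fixes x y :: "'i \<Rightarrow> complex"
  assumes x: "(\<lambda>i. (cmod (x i))\<^sup>2) summable_on UNIV" and y: "(\<lambda>i. (cmod (y i))\<^sup>2) summable_on UNIV"
  shows "(\<lambda>i. (cmod (x i + y i))\<^sup>2) summable_on UNIV"
proof (rule Infinite_Sum.summable_on_comparison_test[where f = "\<lambda>i. 2 * (cmod (x i))\<^sup>2 + 2 * (cmod (y i))\<^sup>2"])
  show "(\<lambda>i. 2 * (cmod (x i))\<^sup>2 + 2 * (cmod (y i))\<^sup>2) summable_on UNIV"
    by (intro summable_on_add summable_on_cmult_right x y)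
  fix i
  have "(cmod (x i + y i))\<^sup>2 \<le> (cmod (x i) + cmod (y i))\<^sup>2"
    by (intro power_mono norm_triangle_ineq) simp
  also have "\<dots> \<le> 2 * (cmod (x i))\<^sup>2 + 2 * (cmod (y i))\<^sup>2"
    using sum_squares_bound[of "cmod (x i)" "cmod (y i)"] by (simp add: power2_sum)
  finally show "(cmod (x i + y i))\<^sup>2 \<le> 2 * (cmod (x i))\<^sup>2 + 2 * (cmod (y i))\<^sup>2" .
qed simp

lemma square_summable_scale:
  fixes x :: "'i \<Rightarrow> complex"
  assumes "(\<lambda>i. (cmod (x i))\<^sup>2) summable_on UNIV"
  shows "(\<lambda>i. (cmod (c * x i))\<^sup>2) summable_on UNIV"
  using summable_on_cmult_right[OF assms, of "(cmod c)\<^sup>2"] by (simp add: norm_mult power_mult_distrib)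

text \<open>Linear in the first variable, antilinear in the second.\<close>

lift_definition cinner :: "'i ell2 \<Rightarrow> 'i ell2 \<Rightarrow> complex"
  is "\<lambda>x y. \<Sum>\<^sub>\<infinity>i. x i * cnj (y i)" .

lift_definition scaleC :: "complex \<Rightarrow> 'i ell2 \<Rightarrow> 'i ell2"  (infixr \<open>*\<^sub>C\<close> 75)
  is "\<lambda>c x i. c * x i"
  by (simp add: square_summable_scale)

instantiation ell2 :: (type) real_vector
begin
lift_definition zero_ell2 :: "'a ell2" is "\<lambda>_. 0" by simp
lift_definition plus_ell2 :: "'a ell2 \<Rightarrow> 'a ell2 \<Rightarrow> 'a ell2" is "\<lambda>x y i. x i + y i"
  by (simp add: square_summable_add)
lift_definition uminus_ell2 :: "'a ell2 \<Rightarrow> 'a ell2" is "\<lambda>x i. - x i" by simp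
lift_definition minus_ell2 :: "'a ell2 \<Rightarrow> 'a ell2 \<Rightarrow> 'a ell2" is "\<lambda>x y i. x i - y i"
  subgoal for x y using square_summable_add[of x "\<lambda>i. - y i"] by simp
  done
lift_definition scaleR_ell2 :: "real \<Rightarrow> 'a ell2 \<Rightarrow> 'a ell2" is "\<lambda>r x i. complex_of_real r * x i"
  by (rule square_summable_scale)
instance by standard (transfer, auto simp: algebra_simps)+
end

lemma summable_cinner: "(\<lambda>i. norm (coord x i * cnj (coord y i))) summable_on UNIV"
  by (rule square_summable_product) (use coord[of x] coord[of y] in auto)

lemma summable_cinner': "(\<lambda>i. coord x i * cnj (coord y i)) summable_on UNIV"
  by (rule Infinite_Sum.abs_summable_summable[OF summable_cinner])

lemma coord_simps [simp]:
  "coord 0 i = 0" "coord (x + y) i = coord x i + coord y i" "coord (- x) i = - coord x i"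
  "coord (x - y) i = coord x i - coord y i" "coord (r *\<^sub>R x) i = complex_of_real r * coord x i"
  "coord (c *\<^sub>C x) i = c * coord x i"
  by (transfer, simp)+

lemma ell2_eqI: "(\<And>i. coord x i = coord y i) \<Longrightarrow> x = y"
  by transfer auto

lemma cinner_add_left: "cinner (x + y) z = cinner x z + cinner y z"
  by (simp add: cinner.rep_eq distrib_right infsum_add summable_cinner')

lemma cinner_scaleC_left: "cinner (c *\<^sub>C x) z = c * cinner x z"
  by (simp add: cinner.rep_eq mult.assoc infsum_cmult_right')

lemma cinner_commute: "cinner x y = cnj (cinner y x)"
  by (simp add: cinner.rep_eq mult.commute flip: infsum_cnj)

lemma cinner_add_right: "cinner x (y + z) = cinner x y + cinner x z"
  by (metis cinner_add_left cinner_commute complex_cnj_add)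

lemma cinner_scaleC_right: "cinner x (c *\<^sub>C z) = cnj c * cinner x z"
  by (metis cinner_scaleC_left cinner_commute complex_cnj_mult)

lemma cinner_self: "cinner x x = complex_of_real (\<Sum>\<^sub>\<infinity>i. (cmod (coord x i))\<^sup>2)"
proof -
  have "(\<lambda>i. (cmod (coord x i))\<^sup>2) summable_on UNIV" using coord[of x] by simp
  then have "((\<lambda>i. complex_of_real ((cmod (coord x i))\<^sup>2)) has_sum
      complex_of_real (\<Sum>\<^sub>\<infinity>i. (cmod (coord x i))\<^sup>2)) UNIV"
    by (simp only: has_sum_of_real_iff has_sum_infsum)
  then show ?thesis
    unfolding cinner.rep_eq complex_norm_square by (rule infsumI)
qed

lemma scaleR_scaleC: "r *\<^sub>R x = complex_of_real r *\<^sub>C x" for x :: "'i ell2"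
  by (rule ell2_eqI) simp

instantiation ell2 :: (type) real_inner
begin
definition inner_ell2 :: "'a ell2 \<Rightarrow> 'a ell2 \<Rightarrow> real" where "inner_ell2 x y = Re (cinner x y)"
definition norm_ell2 :: "'a ell2 \<Rightarrow> real" where "norm_ell2 x = sqrt (Re (cinner x x))"
definition sgn_ell2 :: "'a ell2 \<Rightarrow> 'a ell2" where "sgn_ell2 x = x /\<^sub>R norm x"
definition dist_ell2 :: "'a ell2 \<Rightarrow> 'a ell2 \<Rightarrow> real" where "dist_ell2 x y = norm (x - y)"
definition uniformity_ell2 :: "('a ell2 \<times> 'a ell2) filter" where
  "uniformity_ell2 = (INF e\<in>{0 <..}. principal {(x, y). dist x y < e})"
definition open_ell2 :: "'a ell2 set \<Rightarrow> bool" where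
  "open_ell2 U \<longleftrightarrow> (\<forall>x\<in>U. \<forall>\<^sub>F (x', y) in uniformity. x' = x \<longrightarrow> y \<in> U)"
instance
proof
  fix x y z :: "'a ell2" and r :: real
  show "inner x y = inner y x"
    unfolding inner_ell2_def by (subst cinner_commute) simp
  show "inner (x + y) z = inner x z + inner y z"
    by (simp add: inner_ell2_def cinner_add_left)
  show "inner (r *\<^sub>R x) y = r * inner x y"
    by (simp add: inner_ell2_def scaleR_scaleC cinner_scaleC_left)
  show "0 \<le> inner x x"
    by (simp add: inner_ell2_def cinner_self infsum_nonneg)
  show "inner x x = 0 \<longleftrightarrow> x = 0"
  proof
    assume "inner x x = 0"
    then have "(\<Sum>\<^sub>\<infinity>i. (cmod (coord x i))\<^sup>2) \<le> 0" by (simp add: inner_ell2_def cinner_self)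
    then have "(cmod (coord x i))\<^sup>2 = 0" for i
      by (rule nonneg_infsum_le_0D) (use coord[of x] in auto)
    then show "x = 0" by (intro ell2_eqI) simp
  qed (simp add: inner_ell2_def cinner_self)
qed (simp_all add: inner_ell2_def norm_ell2_def sgn_ell2_def dist_ell2_def
       uniformity_ell2_def open_ell2_def)
end

lemma norm_ell2_square: "(norm x)\<^sup>2 = (\<Sum>\<^sub>\<infinity>i. (cmod (coord x i))\<^sup>2)" for x :: "'i ell2"
  by (simp add: norm_ell2_def cinner_self infsum_nonneg)

lemma cinner_self_norm: "cinner x x = complex_of_real ((norm x)\<^sup>2)"
  by (simp only: cinner_self norm_ell2_square)

lemma norm_scaleC [simp]: "norm (c *\<^sub>C x) = cmod c * norm x"
proof -
  have "(norm (c *\<^sub>C x))\<^sup>2 = (cmod c * norm x)\<^sup>2"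
    by (simp add: norm_ell2_square norm_mult power_mult_distrib infsum_cmult_right')
  then show ?thesis by simp
qed

lemma cinner_bound: "cmod (cinner x y) \<le> norm x * norm y"
proof (cases "cinner x y = 0")
  case False
  define c where "c = cnj (cinner x y) / cmod (cinner x y)"
  have c: "cmod c = 1" using False by (simp add: c_def norm_divide)
  have "cinner (c *\<^sub>C x) y = complex_of_real (cmod (cinner x y))"
    using False by (simp add: c_def cinner_scaleC_left field_simps complex_norm_square[symmetric]
        power2_eq_square[symmetric] del: of_real_power)
      (simp add: power2_eq_square complex_norm_square mult.commute)
  then have "cmod (cinner x y) = inner (c *\<^sub>C x) y" by (simp add: inner_ell2_def)
  also have "\<dots> \<le> norm (c *\<^sub>C x) * norm y" by (rule norm_cauchy_schwarz)
  finally show ?thesis using c by simp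
qed simp

lemma cinner_extI: "(\<And>y. cinner x y = cinner x' y) \<Longrightarrow> x = x'" for x x' :: "'i ell2"
proof -
  assume *: "\<And>y. cinner x y = cinner x' y"
  have "cinner (x - x') y = 0" for y
    using * cinner_add_left[of "x - x'" x' y] by simp
  from this[of "x - x'"] show "x = x'" by (simp add: cinner_self_norm)
qed

lift_definition ket :: "'i \<Rightarrow> 'i ell2" is "\<lambda>i j. if j = i then 1 else 0"
  subgoal for i
    by (rule finite_nonzero_values_imp_summable_on, rule finite_subset[of _ "{i}"]) auto
  done

text \<open>The Hilbert space tensor product of \<open>\<ell>\<^sup>2(I)\<close> and \<open>\<ell>\<^sup>2(J)\<close> is \<open>\<ell>\<^sup>2(I \<times> J)\<close>.\<close>

lift_definition tensor :: "'i ell2 \<Rightarrow> 'j ell2 \<Rightarrow> ('i \<times> 'j) ell2"  (infixr \<open>\<otimes>\<^sub>2\<close> 70)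
  is "\<lambda>x y (i, j). x i * y j"
proof -
  fix x :: "'i \<Rightarrow> complex" and y :: "'j \<Rightarrow> complex"
  assume "(\<lambda>i. (cmod (x i))\<^sup>2) summable_on UNIV" and "(\<lambda>i. (cmod (y i))\<^sup>2) summable_on UNIV"
  then have "(\<lambda>(i, j). (cmod (x i))\<^sup>2 * (cmod (y j))\<^sup>2) summable_on UNIV \<times> UNIV"
    by (intro summable_on_SigmaI[where g = "\<lambda>i. (cmod (x i))\<^sup>2 * (\<Sum>\<^sub>\<infinity>j. (cmod (y j))\<^sup>2)"])
      (auto intro!: has_sum_cmult_right summable_on_cmult_left has_sum_infsum)
  then show "(\<lambda>k. (cmod (case k of (i, j) \<Rightarrow> x i * y j))\<^sup>2) summable_on UNIV"
    by (simp add: case_prod_unfold norm_mult power_mult_distrib)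
qed

lemma tensor_add_left: "(x + x') \<otimes>\<^sub>2 y = x \<otimes>\<^sub>2 y + x' \<otimes>\<^sub>2 y"
  and tensor_add_right: "x \<otimes>\<^sub>2 (y + y') = x \<otimes>\<^sub>2 y + x \<otimes>\<^sub>2 y'"
  and tensor_scaleC_left: "(c *\<^sub>C x) \<otimes>\<^sub>2 y = c *\<^sub>C (x \<otimes>\<^sub>2 y)"
  and tensor_scaleC_right: "x \<otimes>\<^sub>2 (c *\<^sub>C y) = c *\<^sub>C (x \<otimes>\<^sub>2 y)"
  by (rule ell2_eqI; auto simp: tensor.rep_eq case_prod_unfold algebra_simps)+

lemma norm_tensor: "norm (x \<otimes>\<^sub>2 y) = norm x * norm y"
proof -
  let ?F = "\<lambda>(i, j). (cmod (coord x i))\<^sup>2 * (cmod (coord y j))\<^sup>2"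
  have eq: "(cmod (coord (x \<otimes>\<^sub>2 y) k))\<^sup>2 = ?F k" for k
    by (simp add: tensor.rep_eq case_prod_unfold norm_mult power_mult_distrib)
  have summ: "?F summable_on UNIV \<times> UNIV"
    using coord[of "x \<otimes>\<^sub>2 y"] by (simp add: eq)
  have "(norm (x \<otimes>\<^sub>2 y))\<^sup>2 = infsum ?F (UNIV \<times> UNIV)"
    by (simp add: norm_ell2_square eq)
  also have "\<dots> = (\<Sum>\<^sub>\<infinity>i. \<Sum>\<^sub>\<infinity>j. (cmod (coord x i))\<^sup>2 * (cmod (coord y j))\<^sup>2)"
    using infsum_Sigma'_banach[OF summ] by simp
  also have "\<dots> = (norm x * norm y)\<^sup>2"
    by (simp add: norm_ell2_square power_mult_distrib infsum_cmult_right' infsum_cmult_left')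
  finally show ?thesis by simp
qed


section \<open>Bounded operators\<close>

text \<open>
  \<open>Bop\<close> is the space of bounded complex-linear operators, inside the library's normed space of
  bounded real-linear maps; the norm is the operator norm.
\<close>

definition Bop :: "('i ell2 \<Rightarrow>\<^sub>L 'j ell2) set" where
  "Bop = {T. \<forall>c x. blinfun_apply T (c *\<^sub>C x) = c *\<^sub>C blinfun_apply T x}"

definition scaleC_op :: "complex \<Rightarrow> ('i ell2 \<Rightarrow>\<^sub>L 'j ell2) \<Rightarrow> ('i ell2 \<Rightarrow>\<^sub>L 'j ell2)" where
  "scaleC_op c T = Blinfun (\<lambda>x. c *\<^sub>C blinfun_apply T x)"

lemma scaleC_op_apply [simp]:
  fixes T :: "'i ell2 \<Rightarrow>\<^sub>L 'j ell2"
  shows "blinfun_apply (scaleC_op c T) x = c *\<^sub>C blinfun_apply T x"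
proof -
  have "bounded_linear (\<lambda>x::'j ell2. c *\<^sub>C x)"
    by (rule bounded_linear_intro[where K = "cmod c"])
      (auto intro!: ell2_eqI simp: algebra_simps)
  from bounded_linear_compose[OF this blinfun.bounded_linear_right[of T]]
  show ?thesis by (simp add: scaleC_op_def bounded_linear_Blinfun_apply)
qed

definition cadj :: "('i ell2 \<Rightarrow>\<^sub>L 'j ell2) \<Rightarrow> ('j ell2 \<Rightarrow>\<^sub>L 'i ell2)" where
  "cadj T = (THE S. S \<in> Bop \<and>
     (\<forall>y x. cinner (blinfun_apply S y) x = cinner y (blinfun_apply T x)))"

definition unitary :: "('i ell2 \<Rightarrow>\<^sub>L 'j ell2) \<Rightarrow> bool" where
  "unitary U \<longleftrightarrow> U \<in> Bop \<and> cadj U o\<^sub>L U = id_blinfun \<and> U o\<^sub>L cadj U = id_blinfun"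

text \<open>
  The predual of \<open>B(\<ell>\<^sup>2(I))\<close>: the normal functionals, \<open>T \<mapsto> \<Sum>n. \<langle>T \<xi>\<^sub>n, \<eta>\<^sub>n\<rangle>\<close>
  with \<open>\<Sum>n. \<parallel>\<xi>\<^sub>n\<parallel>\<^sup>2 < \<infinity>\<close> and \<open>\<Sum>n. \<parallel>\<eta>\<^sub>n\<parallel>\<^sup>2 < \<infinity>\<close>.
\<close>

definition predual :: "(('i ell2 \<Rightarrow>\<^sub>L 'i ell2) \<Rightarrow> complex) set" where
  "predual = {\<omega>. \<exists>\<xi> \<eta> :: nat \<Rightarrow> 'i ell2.
     summable (\<lambda>n. (norm (\<xi> n))\<^sup>2) \<and> summable (\<lambda>n. (norm (\<eta> n))\<^sup>2) \<and>
     \<omega> = (\<lambda>T. \<Sum>n. cinner (blinfun_apply T (\<xi> n)) (\<eta> n))}"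

text \<open>\<open>vec_slice x y W\<close> is \<open>(\<omega>\<^sub>x\<^sub>,\<^sub>y \<otimes> id)(W)\<close>, where \<open>\<omega>\<^sub>x\<^sub>,\<^sub>y(T) = \<langle>T x, y\<rangle>\<close>.\<close>

definition vec_slice ::
  "'i ell2 \<Rightarrow> 'i ell2 \<Rightarrow> (('i \<times> 'j) ell2 \<Rightarrow>\<^sub>L ('i \<times> 'j) ell2) \<Rightarrow> ('j ell2 \<Rightarrow>\<^sub>L 'j ell2)" where
  "vec_slice x y W = (THE R. R \<in> Bop \<and>
     (\<forall>u v. cinner (blinfun_apply R u) v = cinner (blinfun_apply W (x \<otimes>\<^sub>2 u)) (y \<otimes>\<^sub>2 v)))"

text \<open>\<open>right_slice \<omega> W\<close> is \<open>(id \<otimes> \<omega>)(W)\<close>.\<close>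

definition right_slice ::
  "(('j ell2 \<Rightarrow>\<^sub>L 'j ell2) \<Rightarrow> complex) \<Rightarrow> (('i \<times> 'j) ell2 \<Rightarrow>\<^sub>L ('i \<times> 'j) ell2) \<Rightarrow>
   ('i ell2 \<Rightarrow>\<^sub>L 'i ell2)" where
  "right_slice \<omega> W = (THE S. S \<in> Bop \<and>
     (\<forall>x y. cinner (blinfun_apply S x) y = \<omega> (vec_slice x y W)))"


subsection \<open>Adjoints and slices are well defined\<close>

lemma Bop_eqI:
  assumes "\<And>x y. cinner (blinfun_apply S x) y = cinner (blinfun_apply T x) y"
  shows "S = T"
  by (rule blinfun_eqI, rule cinner_extI, rule assms)

lemma ket_expansion: "((\<lambda>i. coord x i *\<^sub>C ket i) has_sum x) UNIV"
proof -
  have sum_coord: "coord (\<Sum>i\<in>F. coord x i *\<^sub>C ket i) j = (if j \<in> F then coord x j else 0)"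
    if "finite F" for F j
    using that by (induction F) (auto simp: ket.rep_eq)
  have x2: "(\<lambda>i. (cmod (coord x i))\<^sup>2) summable_on UNIV" using coord[of x] by simp
  have "((\<lambda>F. (norm (x - (\<Sum>i\<in>F. coord x i *\<^sub>C ket i)))\<^sup>2) \<longlongrightarrow> 0) (finite_subsets_at_top UNIV)"
  proof (rule Lim_transform_eventually)
    show "((\<lambda>F. (norm x)\<^sup>2 - (\<Sum>i\<in>F. (cmod (coord x i))\<^sup>2)) \<longlongrightarrow> 0) (finite_subsets_at_top UNIV)"
      using tendsto_diff[OF tendsto_const has_sum_infsum[OF x2, unfolded has_sum_def],
          of "(norm x)\<^sup>2"] by (simp add: norm_ell2_square)
    have "(norm x)\<^sup>2 - (\<Sum>i\<in>F. (cmod (coord x i))\<^sup>2) =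
          (norm (x - (\<Sum>i\<in>F. coord x i *\<^sub>C ket i)))\<^sup>2" if F: "finite F" for F
    proof -
      have "(norm x)\<^sup>2 = (\<Sum>\<^sub>\<infinity>i\<in>F. (cmod (coord x i))\<^sup>2) + (\<Sum>\<^sub>\<infinity>i\<in>-F. (cmod (coord x i))\<^sup>2)"
        using infsum_Un_disjoint[of "\<lambda>i. (cmod (coord x i))\<^sup>2" F "-F"]
          summable_on_subset_banach[OF x2] by (simp add: norm_ell2_square)
      moreover have "(\<Sum>\<^sub>\<infinity>i\<in>-F. (cmod (coord x i))\<^sup>2) =
          (norm (x - (\<Sum>i\<in>F. coord x i *\<^sub>C ket i)))\<^sup>2"
        unfolding norm_ell2_square
        by (rule infsum_cong_neutral) (auto simp: sum_coord[OF F])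
      ultimately show ?thesis using F by simp
    qed
    then show "\<forall>\<^sub>F F in finite_subsets_at_top UNIV.
        (norm x)\<^sup>2 - (\<Sum>i\<in>F. (cmod (coord x i))\<^sup>2) =
        (norm (x - (\<Sum>i\<in>F. coord x i *\<^sub>C ket i)))\<^sup>2"
      by (auto simp: eventually_finite_subsets_at_top)
  qed
  from tendsto_real_sqrt[OF this]
  have "((\<lambda>F. (\<Sum>i\<in>F. coord x i *\<^sub>C ket i) - x) \<longlongrightarrow> 0) (finite_subsets_at_top UNIV)"
    by (subst tendsto_norm_zero_iff[symmetric]) (simp add: norm_minus_commute)
  then show ?thesis unfolding has_sum_def by (subst Lim_null)
qed

lemma ex1_op_of_form:
  fixes B :: "'i ell2 \<Rightarrow> 'j ell2 \<Rightarrow> complex"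
  assumes add1: "\<And>x x' y. B (x + x') y = B x y + B x' y"
    and scale1: "\<And>c x y. B (c *\<^sub>C x) y = c * B x y"
    and add2: "\<And>x y y'. B x (y + y') = B x y + B x y'"
    and scale2: "\<And>c x y. B x (c *\<^sub>C y) = cnj c * B x y"
    and bound: "\<And>x y. cmod (B x y) \<le> K * norm x * norm y"
  shows "\<exists>!S. S \<in> Bop \<and> (\<forall>x y. cinner (blinfun_apply S x) y = B x y)"
proof (rule ex_ex1I)
  have B0: "B x 0 = 0" for x using add2[of x 0 0] by simp
  have B_sum: "B x (\<Sum>j\<in>F. g j) = (\<Sum>j\<in>F. B x (g j))" for x F and g :: "'j \<Rightarrow> 'j ell2"
    by (induction F rule: infinite_finite_induct) (auto simp: B0 add2)
  have fin: "(\<Sum>j\<in>F. (cmod (B x (ket j)))\<^sup>2) \<le> (K * norm x)\<^sup>2" if F: "finite F" for x F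
  proof -
    define v where "v = (\<Sum>j\<in>F. B x (ket j) *\<^sub>C ket j)"
    have vj: "coord v j = (if j \<in> F then B x (ket j) else 0)" for j
      unfolding v_def using F by (induction F) (auto simp: ket.rep_eq)
    have nv: "(norm v)\<^sup>2 = (\<Sum>j\<in>F. (cmod (B x (ket j)))\<^sup>2)"
    proof -
      have "(norm v)\<^sup>2 = (\<Sum>\<^sub>\<infinity>j\<in>F. (cmod (B x (ket j)))\<^sup>2)"
        unfolding norm_ell2_square by (rule infsum_cong_neutral) (auto simp: vj)
      then show ?thesis using F by simp
    qed
    have "B x v = complex_of_real ((norm v)\<^sup>2)"
      unfolding nv by (simp only: v_def B_sum scale2 of_real_sum)
        (simp add: complex_norm_square mult.commute del: of_real_power)
    then have "(norm v)\<^sup>2 \<le> K * norm x * norm v"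
      using bound[of x v] by (metis norm_of_real abs_power2 abs_norm_cancel power2_abs)
    then have "norm v \<le> K * norm x \<or> norm v = 0"
      by (auto simp: power2_eq_square)
    moreover have "0 \<le> (K * norm x)\<^sup>2" by simp
    ultimately have "(norm v)\<^sup>2 \<le> (K * norm x)\<^sup>2"
      by (auto intro: power_mono)
    then show ?thesis by (simp add: nv)
  qed
  have summ: "(\<lambda>j. (cmod (B x (ket j)))\<^sup>2) summable_on UNIV" for x
    by (rule nonneg_bdd_above_summable_on) (auto intro!: bdd_aboveI2 fin)
  define s where "s x = Abs_ell2 (\<lambda>j. B x (ket j))" for x
  have sj: "coord (s x) j = B x (ket j)" for x j
    unfolding s_def using summ by (simp add: Abs_ell2_inverse)
  have norm_s: "norm (s x) \<le> norm x * \<bar>K\<bar>" for x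
  proof -
    have "(norm (s x))\<^sup>2 \<le> (K * norm x)\<^sup>2"
      unfolding norm_ell2_square sj by (rule infsum_le_finite_sums[OF summ fin]) auto
    then have "norm (s x) \<le> \<bar>K * norm x\<bar>" by (metis abs_le_square_iff abs_norm_cancel)
    then show ?thesis by (simp add: abs_mult mult.commute)
  qed
  have bl: "bounded_linear s"
    by (rule bounded_linear_intro[where K = "\<bar>K\<bar>"])
      (auto intro!: ell2_eqI simp: sj add1 scale1 scaleR_scaleC norm_s)
  have "cinner (s x) y = B x y" for x y
  proof -
    have "bounded_linear (B x)"
    proof (rule bounded_linear_intro[where K = "K * norm x"])
      show "norm (B x y) \<le> norm y * (K * norm x)" for y
        using bound[of x y] by (simp add: mult_ac)
    qed (simp_all add: add2 scaleR_scaleC scale2 scaleR_conv_of_real)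
    from has_sum_bounded_linear[OF this ket_expansion]
    have "((\<lambda>j. coord (s x) j * cnj (coord y j)) has_sum B x y) UNIV"
      by (simp add: o_def scale2 sj mult.commute)
    then show ?thesis by (simp add: cinner.rep_eq infsumI)
  qed
  then show "\<exists>S. S \<in> Bop \<and> (\<forall>x y. cinner (blinfun_apply S x) y = B x y)"
    by (intro exI[of _ "Blinfun s"])
      (auto simp: Bop_def bounded_linear_Blinfun_apply[OF bl] scale1 sj intro!: ell2_eqI)
  show "S = T" if "S \<in> Bop \<and> (\<forall>x y. cinner (blinfun_apply S x) y = B x y)"
    "T \<in> Bop \<and> (\<forall>x y. cinner (blinfun_apply T x) y = B x y)" for S T
    using that by (intro Bop_eqI) simp
qed

lemma cadj:
  assumes "T \<in> Bop"
  shows cadj_Bop: "cadj T \<in> Bop"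
    and cinner_cadj: "cinner (blinfun_apply (cadj T) y) x = cinner y (blinfun_apply T x)"
proof -
  have "\<exists>!S. S \<in> Bop \<and> (\<forall>y x. cinner (blinfun_apply S y) x = cinner y (blinfun_apply T x))"
  proof (rule ex1_op_of_form[where K = "norm T"])
    fix x y
    have "cmod (cinner y (blinfun_apply T x)) \<le> norm y * norm (blinfun_apply T x)"
      by (rule cinner_bound)
    also have "\<dots> \<le> norm y * (norm T * norm x)"
      by (intro mult_left_mono norm_blinfun) simp
    finally show "cmod (cinner y (blinfun_apply T x)) \<le> norm T * norm y * norm x"
      by (simp add: mult_ac)
  qed (use assms in \<open>auto simp: Bop_def cinner_add_left cinner_add_right cinner_scaleC_left
        cinner_scaleC_right blinfun.add_right\<close>)
  from theI'[OF this, folded cadj_def] show "cadj T \<in> Bop"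
    "cinner (blinfun_apply (cadj T) y) x = cinner y (blinfun_apply T x)" by auto
qed

lemma vec_slice:
  assumes "W \<in> Bop"
  shows vec_slice_Bop: "vec_slice x y W \<in> Bop"
    and cinner_vec_slice:
      "cinner (blinfun_apply (vec_slice x y W) u) v = cinner (blinfun_apply W (x \<otimes>\<^sub>2 u)) (y \<otimes>\<^sub>2 v)"
    and norm_vec_slice: "norm (vec_slice x y W) \<le> norm W * norm x * norm y"
proof -
  have bd: "cmod (cinner (blinfun_apply W (x \<otimes>\<^sub>2 u)) (y \<otimes>\<^sub>2 v)) \<le>
      (norm W * norm x * norm y) * norm u * norm v" for u v
  proof -
    have "cmod (cinner (blinfun_apply W (x \<otimes>\<^sub>2 u)) (y \<otimes>\<^sub>2 v)) \<le>
        norm (blinfun_apply W (x \<otimes>\<^sub>2 u)) * norm (y \<otimes>\<^sub>2 v)"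
      by (rule cinner_bound)
    also have "\<dots> \<le> (norm W * norm (x \<otimes>\<^sub>2 u)) * norm (y \<otimes>\<^sub>2 v)"
      by (intro mult_right_mono norm_blinfun) simp
    finally show ?thesis by (simp add: norm_tensor mult_ac)
  qed
  have "\<exists>!R. R \<in> Bop \<and> (\<forall>u v. cinner (blinfun_apply R u) v =
      cinner (blinfun_apply W (x \<otimes>\<^sub>2 u)) (y \<otimes>\<^sub>2 v))"
    by (rule ex1_op_of_form[OF _ _ _ _ bd])
      (use assms in \<open>auto simp: Bop_def cinner_add_left cinner_add_right cinner_scaleC_left
        cinner_scaleC_right blinfun.add_right tensor_add_right tensor_scaleC_right\<close>)
  from theI'[OF this, folded vec_slice_def]
  show "vec_slice x y W \<in> Bop" and R: "cinner (blinfun_apply (vec_slice x y W) u) v =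
      cinner (blinfun_apply W (x \<otimes>\<^sub>2 u)) (y \<otimes>\<^sub>2 v)" for u v by auto
  show "norm (vec_slice x y W) \<le> norm W * norm x * norm y"
  proof (rule norm_blinfun_bound)
    fix u
    define r where "r = blinfun_apply (vec_slice x y W) u"
    have "cmod (cinner r r) = norm r * norm r"
      by (simp add: cinner_self_norm norm_power power2_eq_square norm_mult)
    then have "norm r * norm r \<le> (norm W * norm x * norm y * norm u) * norm r"
      using bd[of u r] R[of u r] by (simp add: r_def)
    then show "norm (blinfun_apply (vec_slice x y W) u) \<le> norm W * norm x * norm y * norm u"
      by (cases "norm r = 0") (auto simp: r_def[symmetric])
  qed simp
qed

lemma predual_bounded_linear:
  fixes \<omega> :: "('i ell2 \<Rightarrow>\<^sub>L 'i ell2) \<Rightarrow> complex"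
  assumes "\<omega> \<in> predual"
  shows predual_add: "\<omega> (S + T) = \<omega> S + \<omega> T"
    and predual_scaleC_op: "\<omega> (scaleC_op c T) = c * \<omega> T"
    and predual_bound: "\<exists>K\<ge>0. \<forall>T. cmod (\<omega> T) \<le> K * norm T"
proof -
  from assms obtain \<xi> \<eta> where \<xi>: "summable (\<lambda>n. (norm (\<xi> n))\<^sup>2)"
    and \<eta>: "summable (\<lambda>n. (norm (\<eta> n))\<^sup>2)"
    and \<omega>: "\<omega> = (\<lambda>T. \<Sum>n. cinner (blinfun_apply T (\<xi> n)) (\<eta> n))"
    by (auto simp: predual_def)
  have prod: "summable (\<lambda>n. norm (\<xi> n) * norm (\<eta> n))"
  proof (rule summable_comparison_test'[where N = 0])
    show "summable (\<lambda>n. (norm (\<xi> n))\<^sup>2 + (norm (\<eta> n))\<^sup>2)" by (rule summable_add[OF \<xi> \<eta>])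
    fix n
    have "2 * (norm (\<xi> n) * norm (\<eta> n)) \<le> (norm (\<xi> n))\<^sup>2 + (norm (\<eta> n))\<^sup>2"
      using sum_squares_bound[of "norm (\<xi> n)" "norm (\<eta> n)"] by simp
    moreover have "0 \<le> norm (\<xi> n) * norm (\<eta> n)" by simp
    ultimately show "norm (norm (\<xi> n) * norm (\<eta> n)) \<le> (norm (\<xi> n))\<^sup>2 + (norm (\<eta> n))\<^sup>2"
      unfolding real_norm_def by linarith
  qed
  have bnd: "cmod (cinner (blinfun_apply T (\<xi> n)) (\<eta> n)) \<le> norm T * (norm (\<xi> n) * norm (\<eta> n))"
    for T :: "'i ell2 \<Rightarrow>\<^sub>L 'i ell2" and n
    using order_trans[OF cinner_bound mult_right_mono[OF norm_blinfun[of T "\<xi> n"]]]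
    by (simp add: mult.assoc)
  have bd: "summable (\<lambda>n. norm T * (norm (\<xi> n) * norm (\<eta> n)))" for T :: "'i ell2 \<Rightarrow>\<^sub>L 'i ell2"
    by (rule summable_mult[OF prod])
  have nsum: "summable (\<lambda>n. cmod (cinner (blinfun_apply T (\<xi> n)) (\<eta> n)))"
    for T :: "'i ell2 \<Rightarrow>\<^sub>L 'i ell2"
    by (rule summable_comparison_test'[OF bd, where N = 0]) (use bnd in auto)
  note sum = summable_norm_cancel[OF nsum]
  show "\<omega> (S + T) = \<omega> S + \<omega> T"
    by (simp add: \<omega> blinfun.add_left cinner_add_left suminf_add[OF sum sum])
  show "\<omega> (scaleC_op c T) = c * \<omega> T"
    by (simp add: \<omega> cinner_scaleC_left suminf_mult[OF sum])
  have "cmod (\<omega> T) \<le> (\<Sum>n. norm (\<xi> n) * norm (\<eta> n)) * norm T" for T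
  proof -
    have "cmod (\<omega> T) \<le> (\<Sum>n. cmod (cinner (blinfun_apply T (\<xi> n)) (\<eta> n)))"
      unfolding \<omega> by (rule summable_norm[OF nsum])
    also have "\<dots> \<le> (\<Sum>n. norm T * (norm (\<xi> n) * norm (\<eta> n)))"
      by (rule suminf_le[OF bnd nsum bd])
    also have "\<dots> = (\<Sum>n. norm (\<xi> n) * norm (\<eta> n)) * norm T"
      unfolding suminf_mult[OF prod] by (rule mult.commute)
    finally show ?thesis .
  qed
  moreover have "0 \<le> (\<Sum>n. norm (\<xi> n) * norm (\<eta> n))" by (rule suminf_nonneg[OF prod]) simp
  ultimately show "\<exists>K\<ge>0. \<forall>T. cmod (\<omega> T) \<le> K * norm T" by blast
qed

lemma right_slice:
  assumes W: "W \<in> Bop" and \<omega>: "\<omega> \<in> predual"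
  shows right_slice_Bop: "right_slice \<omega> W \<in> Bop"
    and cinner_right_slice: "cinner (blinfun_apply (right_slice \<omega> W) x) y = \<omega> (vec_slice x y W)"
proof -
  from predual_bound[OF \<omega>] obtain K where K: "K \<ge> 0" "\<And>T. cmod (\<omega> T) \<le> K * norm T" by blast
  have W': "blinfun_apply W (c *\<^sub>C x) = c *\<^sub>C blinfun_apply W x" for c x
    using W by (simp add: Bop_def)
  have "vec_slice (x + x') y W = vec_slice x y W + vec_slice x' y W"
    "vec_slice x (y + y') W = vec_slice x y W + vec_slice x y' W"
    "vec_slice (c *\<^sub>C x) y W = scaleC_op c (vec_slice x y W)"
    "vec_slice x (c *\<^sub>C y) W = scaleC_op (cnj c) (vec_slice x y W)" for x x' y y' c
    by (rule Bop_eqI, simp add: cinner_vec_slice[OF W] W' blinfun.add_left blinfun.add_right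
        cinner_add_left cinner_add_right cinner_scaleC_left cinner_scaleC_right
        tensor_add_left tensor_scaleC_left)+
  note linear = this
  have "\<exists>!S. S \<in> Bop \<and> (\<forall>x y. cinner (blinfun_apply S x) y = \<omega> (vec_slice x y W))"
  proof (rule ex1_op_of_form[where K = "K * norm W"])
    fix x y
    have "cmod (\<omega> (vec_slice x y W)) \<le> K * norm (vec_slice x y W)" by (rule K)
    also have "\<dots> \<le> K * (norm W * norm x * norm y)"
      by (rule mult_left_mono[OF norm_vec_slice[OF W] K(1)])
    finally show "cmod (\<omega> (vec_slice x y W)) \<le> K * norm W * norm x * norm y"
      by (simp add: mult_ac)
  qed (simp_all add: linear predual_add[OF \<omega>] predual_scaleC_op[OF \<omega>])
  from theI'[OF this, folded right_slice_def] show "right_slice \<omega> W \<in> Bop"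
    "cinner (blinfun_apply (right_slice \<omega> W) x) y = \<omega> (vec_slice x y W)" by auto
qed


section \<open>Coamenability\<close>

text \<open>
  A locally compact quantum group enters through its left multiplicative unitary \<open>W\<close> on
  \<open>L\<^sup>2(G) \<otimes> L\<^sup>2(G)\<close>, with \<open>L\<^sup>2(G)\<close> realised as \<open>\<ell>\<^sup>2\<close> of the index set of an orthonormal basis.
\<close>

definition C0 :: "(('i \<times> 'i) ell2 \<Rightarrow>\<^sub>L ('i \<times> 'i) ell2) \<Rightarrow> ('i ell2 \<Rightarrow>\<^sub>L 'i ell2) set" where
  "C0 W = closure {right_slice \<omega> W |\<omega>. \<omega> \<in> predual}"

definition state_on ::
  "('i ell2 \<Rightarrow>\<^sub>L 'i ell2) set \<Rightarrow> (('i ell2 \<Rightarrow>\<^sub>L 'i ell2) \<Rightarrow> complex) \<Rightarrow> bool" where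
  "state_on A \<epsilon> \<longleftrightarrow>
     (\<forall>a\<in>A. \<forall>b\<in>A. \<epsilon> (a + b) = \<epsilon> a + \<epsilon> b) \<and>
     (\<forall>c. \<forall>a\<in>A. \<epsilon> (scaleC_op c a) = c * \<epsilon> a) \<and>
     (\<forall>a\<in>A. \<epsilon> (cadj a o\<^sub>L a) \<in> \<real>\<^sub>\<ge>\<^sub>0) \<and>
     bdd_above ((\<lambda>a. cmod (\<epsilon> a)) ` {a \<in> A. norm a \<le> 1}) \<and>
     (SUP a\<in>{a \<in> A. norm a \<le> 1}. cmod (\<epsilon> a)) = 1"

text \<open>
  For a functional \<open>\<epsilon>\<close> on \<open>C\<^sub>0(G)\<close>, the slice \<open>(\<epsilon> \<otimes> id)(W)\<close> is the operator \<open>T\<close> with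
  \<open>\<omega>(T) = \<epsilon>((id \<otimes> \<omega>)(W))\<close> for all normal \<open>\<omega>\<close>; there is at most one.
\<close>

definition has_left_slice ::
  "(('i ell2 \<Rightarrow>\<^sub>L 'i ell2) \<Rightarrow> complex) \<Rightarrow> (('i \<times> 'i) ell2 \<Rightarrow>\<^sub>L ('i \<times> 'i) ell2) \<Rightarrow>
   ('i ell2 \<Rightarrow>\<^sub>L 'i ell2) \<Rightarrow> bool" where
  "has_left_slice \<epsilon> W T \<longleftrightarrow> T \<in> Bop \<and> (\<forall>\<omega>\<in>predual. \<omega> T = \<epsilon> (right_slice \<omega> W))"

definition coamenable :: "(('i \<times> 'i) ell2 \<Rightarrow>\<^sub>L ('i \<times> 'i) ell2) \<Rightarrow> bool" where
  "coamenable W \<longleftrightarrow> (\<exists>\<epsilon>. state_on (C0 W) \<epsilon> \<and> has_left_slice \<epsilon> W id_blinfun)"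


section \<open>The extended quantum \<open>SU(1,1)\<close> group\<close>

definition qpoch :: "real \<Rightarrow> real \<Rightarrow> nat \<Rightarrow> real" where
  "qpoch a r k = (\<Prod>l<k. 1 - a * r ^ l)"

definition qpoch_inf :: "real \<Rightarrow> real \<Rightarrow> real" where
  "qpoch_inf a r = (\<Prod>l. 1 - a * r ^ l)"

definition Iq :: "real \<Rightarrow> real set" where
  "Iq q = {q powi k |k :: int. True} \<union> {- (q ^ n) |n :: nat. n \<ge> 1}"

definition chi :: "real \<Rightarrow> real \<Rightarrow> int" where
  "chi q t = \<lfloor>log q \<bar>t\<bar>\<rfloor>"

lemma chi_eq:
  assumes "0 < q" "q < 1" "\<bar>t\<bar> = q powi k"
  shows "chi q t = k" and "real_of_int (chi q t) = log q \<bar>t\<bar>"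
proof -
  have "log q \<bar>t\<bar> = real_of_int k"
    using assms by (simp add: powr_real_of_int'[symmetric])
  then show "chi q t = k" and "real_of_int (chi q t) = log q \<bar>t\<bar>"
    by (simp_all add: chi_def)
qed

definition nu :: "real \<Rightarrow> real \<Rightarrow> real" where
  "nu q t = q powr ((real_of_int (chi q t) - 1) * (real_of_int (chi q t) - 2) / 2)"

definition kappa :: "real \<Rightarrow> real" where
  "kappa x = sgn x * x\<^sup>2"

definition c_q :: "real \<Rightarrow> real" where
  "c_q q = inverse (sqrt 2 * q * (qpoch_inf (q\<^sup>2) (q\<^sup>2) * qpoch_inf (- (q\<^sup>2)) (q\<^sup>2)))"

definition s_sign :: "real \<Rightarrow> real \<Rightarrow> real" where
  "s_sign x y = (if x > 0 \<and> y < 0 then - 1 else 1)"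

definition Psi :: "real \<Rightarrow> real \<Rightarrow> real \<Rightarrow> real \<Rightarrow> real" where
  "Psi q a b z = (\<Sum>n. qpoch a (q\<^sup>2) n * qpoch_inf (b * q ^ (2 * n)) (q\<^sup>2) / qpoch (q\<^sup>2) (q\<^sup>2) n
                        * (- 1) ^ n * q ^ (n * (n - 1)) * z ^ n)"

definition a_coeff :: "real \<Rightarrow> real \<Rightarrow> real \<Rightarrow> real \<Rightarrow> real" where
  "a_coeff q p x y =
     (if sgn (x * y) \<noteq> sgn p then 0
      else c_q q * s_sign x y * (- 1) powi (chi q p) * (- sgn y) powi (chi q x) * \<bar>y\<bar>
           * nu q (p * y / x)
           * sqrt (qpoch_inf (- kappa p) (q\<^sup>2) * qpoch_inf (- kappa y) (q\<^sup>2)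
                   / qpoch_inf (- kappa x) (q\<^sup>2))
           * Psi q (- (q\<^sup>2) / kappa y) (q\<^sup>2 * kappa (x / y)) (q\<^sup>2 * kappa (x / p)))"

text \<open>
  The Hilbert space \<open>\<ell>\<^sup>2(I\<^sub>q)\<close> is modelled over an index type not depending on \<open>q\<close>, identified
  with \<open>I\<^sub>q\<close> by \<open>Iq_point q\<close>; \<open>NegPt n\<close> stands for \<open>-q\<^sup>n\<^sup>+\<^sup>1\<close>.
\<close>

datatype iq = PosPt int | NegPt nat

fun Iq_point :: "real \<Rightarrow> iq \<Rightarrow> real" where
  "Iq_point q (PosPt k) = q powi k"
| "Iq_point q (NegPt n) = - (q ^ Suc n)"

lemma bij_betw_Iq_point:
  assumes q: "0 < q" "q < 1"
  shows "bij_betw (Iq_point q) UNIV (Iq q)"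
proof (rule bij_betwI')
  fix i j
  have pos: "q powi k > 0" "q ^ n > 0" for k n using q by simp_all
  have powi: "q powi k = q powi l \<longleftrightarrow> k = l" for k l
    using chi_eq(1)[OF q, of "q powi k"] pos by (metis abs_of_pos)
  have pow: "q ^ m = q ^ n \<longleftrightarrow> m = n" for m n
    using powi[of "int m" "int n"] by simp
  have neg: "q powi k \<noteq> - (q ^ n)" for k n
    using pos(1)[of k] pos(2)[of n] by linarith
  show "Iq_point q i = Iq_point q j \<longleftrightarrow> i = j"
    using powi pow[of "Suc _" "Suc _"] neg[of _ "Suc _"] neg[of _ "Suc _", symmetric]
    by (cases i; cases j) (simp_all del: power_Suc)
next
  show "Iq_point q i \<in> Iq q" for i
    by (cases i) (auto simp: Iq_def simp del: power_Suc)
next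
  fix x assume "x \<in> Iq q"
  then consider k where "x = q powi k" | n where "x = - (q ^ n)" "n \<ge> 1"
    by (auto simp: Iq_def)
  then show "\<exists>i\<in>UNIV. x = Iq_point q i"
  proof cases
    case 1 then show ?thesis by (intro bexI[of _ "PosPt k"]) auto
  next
    case 2 then show ?thesis by (intro bexI[of _ "NegPt (n - 1)"]) auto
  qed
qed

type_synonym su_ix = "int \<times> iq \<times> iq"

text \<open>The basis vector \<open>f\<^sub>m\<^sub>,\<^sub>p\<^sub>,\<^sub>t\<close> of \<open>L\<^sup>2(G)\<close>, meaningful for \<open>p\<close> and \<open>t\<close> in \<open>I\<^sub>q\<close>.\<close>

definition f_basis :: "real \<Rightarrow> int \<Rightarrow> real \<Rightarrow> real \<Rightarrow> su_ix ell2" where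
  "f_basis q m p t = ket (m, inv (Iq_point q) p, inv (Iq_point q) t)"

definition w_pt :: "real \<Rightarrow> real \<Rightarrow> int \<Rightarrow> real \<Rightarrow> real \<Rightarrow> real \<Rightarrow> real \<Rightarrow> real" where
  "w_pt q p1 m2 p2 t2 y z = sgn (p2 * t2) * (y * z / p1) * q powi m2"

definition SUq11_ext_unitary ::
  "real \<Rightarrow> ((su_ix \<times> su_ix) ell2 \<Rightarrow>\<^sub>L (su_ix \<times> su_ix) ell2) \<Rightarrow> bool" where
  "SUq11_ext_unitary q W \<longleftrightarrow> unitary W \<and>
     (\<forall>m1 m2. \<forall>p1\<in>Iq q. \<forall>t1\<in>Iq q. \<forall>p2\<in>Iq q. \<forall>t2\<in>Iq q.
        ((\<lambda>(y, z).
            (\<bar>t2 / y\<bar> * a_coeff q t2 p1 y * a_coeff q p2 z (w_pt q p1 m2 p2 t2 y z)) *\<^sub>R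
            (f_basis q (m1 + m2 - chi q (p1 * p2 / (t2 * z))) z t1 \<otimes>\<^sub>2
             f_basis q (chi q (p1 * p2 / (t2 * z))) (w_pt q p1 m2 p2 t2 y z) y))
         has_sum blinfun_apply (cadj W) (f_basis q m1 p1 t1 \<otimes>\<^sub>2 f_basis q m2 p2 t2))
        {(y, z). y \<in> Iq q \<and> z \<in> Iq q \<and> w_pt q p1 m2 p2 t2 y z \<in> Iq q})"

end

theory Submission
  imports Defs
begin

text \<open>
  Fix \<open>t \<in> I\<^sub>q\<close>. As \<open>p = q\<^bsup>-n\<^esup> \<rightarrow> \<infinity>\<close>, the coefficient \<open>a\<^sub>t(p, t)\<close> tends to \<open>1\<close>. The matrix
  coefficient of \<open>W\<^sup>*\<close> between \<open>f\<^bsub>0,p,1\<^esub> \<otimes> f\<^bsub>m,b,c\<^esub>\<close> and \<open>f\<^bsub>0,p',1\<^esub> \<otimes> f\<^bsub>m,b,c\<^esub>\<close> is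
  \<open>a\<^sub>c(p, c) a\<^sub>b(p', b)\<close> if \<open>p' / p = \<bar>b / c\<bar> q\<^bsup>-m\<^esup>\<close>, and \<open>0\<close> otherwise. So asymptotically \<open>W\<^sup>*\<close> moves
  \<open>p\<close> by a fixed power of \<open>q\<close>, and the normalised sums \<open>\<xi>\<^sub>n\<close> of \<open>f\<^bsub>0,p,1\<^esub>\<close> over
  \<open>p = q\<^bsup>-n\<^esup>, \<dots>, q\<^bsup>-2n\<^esup>\<close> satisfy \<open>\<langle>W\<^sup>*(\<xi>\<^sub>n \<otimes> u), \<xi>\<^sub>n \<otimes> u\<rangle> \<rightarrow> 1\<close> for every basis vector \<open>u\<close>. Since
  \<open>W\<close> is unitary, \<open>W(\<xi>\<^sub>n \<otimes> u) - \<xi>\<^sub>n \<otimes> u \<rightarrow> 0\<close> for all \<open>u\<close>, and the vector states of the \<open>\<xi>\<^sub>n\<close> converge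
  on \<open>C\<^sub>0\<close> to the counit.

  For the limit of \<open>a\<^sub>t(p, t)\<close>, put \<open>Q = q\<^sup>2\<close> and \<open>\<bar>t\<bar> = q\<^sup>k\<close>. The series to study is
  \<open>\<Psi>(a; \<plusminus>Q\<^bsup>1-N\<^esup>; \<plusminus>Q\<^bsup>1-N\<^esup>)\<close> with \<open>N = n + k\<close>. For \<open>t > 0\<close> its first \<open>N\<close> terms vanish and the tail tends to
  an Euler series for \<open>(Q; Q)\<^sub>\<infinity>\<close>; the remaining factor is evaluated by the quasi-periodicity of the theta
  function. For \<open>t < 0\<close> the series has \<open>k\<close> terms, all of the same order, which the finite \<open>q\<close>-binomial
  theorem sums up.
\<close>

section \<open>Limits of \<open>q\<close>-series\<close>

lemma qpoch_0 [simp]: "qpoch a r 0 = 1"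
  by (simp add: qpoch_def)

lemma qpoch_Suc: "qpoch a r (Suc n) = qpoch a r n * (1 - a * r ^ n)"
  by (simp add: qpoch_def)

lemma qpoch_add: "qpoch a r (m + n) = qpoch a r m * qpoch (a * r ^ m) r n"
  by (induction n) (simp_all add: qpoch_Suc power_add mult.assoc)

lemma qpoch_Suc': "qpoch a r (Suc n) = (1 - a) * qpoch (a * r) r n"
  using qpoch_add[of a r 1 n] by (simp add: qpoch_Suc)

text \<open>Over \<open>int\<close> no subtraction is truncated, so exponents with negative summands
  can be compared by ring algebra.\<close>

lemma two_choose_two: "2 * int (n choose 2) = int n * (int n - 1)"
  by (induction n) (simp_all add: numeral_2_eq_2 algebra_simps)

context
  fixes r :: real
  assumes r: "0 < r" "r < 1"
begin

lemma powi_minus_of_nat: "r powi (- int n) = inverse (r ^ n)"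
  by (simp add: power_int_minus)

section \<open>Infinite q-shifted factorials and the theta product\<close>

lemma has_prod_qpoch_inf: "(\<lambda>l. 1 - a * r ^ l) has_prod qpoch_inf a r"
  unfolding qpoch_inf_def
proof (intro convergent_prod_has_prod abs_convergent_prod_imp_convergent_prod
    summable_imp_abs_convergent_prod)
  show "summable (\<lambda>i. norm (1 - a * r ^ i - 1))"
    using r by (simp add: abs_mult summable_mult summable_geometric)
qed

lemma qpoch_tendsto: "qpoch a r \<longlonglongrightarrow> qpoch_inf a r"
proof -
  have "(\<lambda>n. qpoch a r (Suc n)) \<longlonglongrightarrow> qpoch_inf a r"
    using has_prod_imp_tendsto[OF has_prod_qpoch_inf] by (simp add: qpoch_def lessThan_Suc_atMost)
  then show ?thesis by (simp only: filterlim_sequentially_Suc)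
qed

lemma qpoch_inf_split: "qpoch_inf a r = qpoch a r n * qpoch_inf (a * r ^ n) r"
proof (rule LIMSEQ_unique)
  show "(\<lambda>m. qpoch a r (m + n)) \<longlonglongrightarrow> qpoch_inf a r"
    by (rule LIMSEQ_ignore_initial_segment[OF qpoch_tendsto])
  show "(\<lambda>m. qpoch a r (m + n)) \<longlonglongrightarrow> qpoch a r n * qpoch_inf (a * r ^ n) r"
    unfolding add.commute[of _ n] qpoch_add by (intro tendsto_mult tendsto_const qpoch_tendsto)
qed

lemma qpoch_inf_step: "qpoch_inf a r = (1 - a) * qpoch_inf (a * r) r"
  using qpoch_inf_split[of a 1] by (simp add: qpoch_Suc)

lemma qpoch_inf_eq_0:
  assumes "a * r ^ n = 1"
  shows "qpoch_inf a r = 0"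
  using assms by (subst qpoch_inf_split[of _ "Suc n"]) (simp add: qpoch_Suc)

lemma one_minus_mult_power_pos:
  assumes "a < 1"
  shows "0 < 1 - a * r ^ n"
proof (cases "0 \<le> a")
  case True
  have "r ^ n \<le> 1" using r by (simp add: power_le_one)
  then have "a * r ^ n \<le> a" using True by (simp add: mult_left_le)
  then show ?thesis using assms by linarith
next
  case False
  then have "a * r ^ n \<le> 0" using r by (simp add: mult_nonpos_nonneg)
  then show ?thesis by linarith
qed

lemma qpoch_pos: "a < 1 \<Longrightarrow> 0 < qpoch a r n"
  unfolding qpoch_def by (intro prod_pos) (simp add: one_minus_mult_power_pos del: diff_gt_0_iff_gt)

lemma qpoch_inf_pos: "a < 1 \<Longrightarrow> 0 < qpoch_inf a r"
  by (rule has_prod_pos[OF has_prod_qpoch_inf]) (rule one_minus_mult_power_pos)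

text \<open>Reflection: 1 + r^(-l) = r^(-l) (1 + r^l) for l = 1, ..., M, and the extracted powers
  multiply to the reciprocal of \<open>r ^ (Suc M choose 2)\<close>. The factor with exponent 0 is
  the 2.\<close>

lemma qpoch_inf_minus_powi:
  "r ^ (Suc M choose 2) * qpoch_inf (- (r powi (- int M))) r = 2 * qpoch (- r) r M * qpoch_inf (- r) r"
proof (induction M)
  case 0
  then show ?case by (simp add: qpoch_inf_step[of "-1"] numeral_2_eq_2)
next
  case (Suc M)
  have *: "- (r powi (- int (Suc M))) * r = - (r powi (- int M))"
    unfolding powi_minus_of_nat using r by (simp add: field_simps)
  have **: "r ^ Suc M * (1 + r powi (- int (Suc M))) = 1 + r * r ^ M"
    unfolding powi_minus_of_nat using r by (simp add: field_simps)
  have "r ^ (Suc (Suc M) choose 2) * qpoch_inf (- (r powi (- int (Suc M)))) r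
    = (r ^ Suc M * (1 + r powi (- int (Suc M)))) * (r ^ (Suc M choose 2) * qpoch_inf (- (r powi (- int M))) r)"
    by (subst qpoch_inf_step) (simp only: *, simp add: numeral_2_eq_2 power_add)
  also have "\<dots> = 2 * qpoch (- r) r (Suc M) * qpoch_inf (- r) r"
    unfolding ** Suc.IH by (simp add: qpoch_Suc)
  finally show ?case .
qed

text \<open>Passing from k to k + 1 removes 1 + r^k from the first product and adds 1 + r^(-k) to
  the second. The resulting r^(-k) is compensated by the power in front, so the left side is
  constant in k and can be read off at k = 0.\<close>

lemma qpoch_inf_theta:
  "r powr (real_of_int (k * (k - 1)) / 2) * (qpoch_inf (- (r powi k)) r * qpoch_inf (- (r powi (1 - k))) r)
    = 2 * (qpoch_inf (- r) r)\<^sup>2"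
    (is "?E k * (?T k) = _")
proof -
  have step: "?E (k + 1) * ?T (k + 1) = ?E k * ?T k" for k
  proof -
    have 1: "qpoch_inf (- (r powi k)) r = (1 + r powi k) * qpoch_inf (- (r powi (k + 1))) r"
      by (subst qpoch_inf_step) (use r in \<open>simp add: power_int_add mult.commute\<close>)
    have 2: "qpoch_inf (- (r powi (- k))) r = (1 + r powi (- k)) * qpoch_inf (- (r powi (1 - k))) r"
      by (subst qpoch_inf_step)
        (use r in \<open>simp add: power_int_add power_int_diff power_int_minus divide_inverse mult.commute\<close>)
    have "real_of_int ((k + 1) * (k + 1 - 1)) / 2 = real_of_int (k * (k - 1)) / 2 + real_of_int k"
      by (simp add: field_simps)
    then have 3: "?E (k + 1) = ?E k * r powi k"
      using r by (simp only: powr_add) (simp add: powr_real_of_int')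
    have 4: "r powi k * (1 + r powi (- k)) = 1 + r powi k"
      using r by (simp add: power_int_minus field_simps)
    show ?thesis
      using 4 unfolding 3 1 by (simp add: 2 mult.left_commute[of _ "1 + r powi (- k)"]) (simp add: algebra_simps)
  qed
  have "?E k * ?T k = ?E 0 * ?T 0"
  proof (induction k rule: int_induct[where k = 0])
    case base
    show ?case by (rule refl)
  next
    case (step1 i) then show ?case using step[of i] by simp
  next
    case (step2 i) then show ?case using step[of "i - 1"] by simp
  qed
  also have "\<dots> = 2 * (qpoch_inf (- r) r)\<^sup>2"
    using r by (simp add: qpoch_inf_step[of "-1"] power2_eq_square)
  finally show ?thesis .
qed

section \<open>Euler's series for the infinite product\<close>

lemma Euler_summable: "summable (\<lambda>i. norm ((- 1) ^ i * r ^ (i choose 2) / qpoch r r i * x ^ i))"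
proof -
  define c where "c i = (- 1) ^ i * r ^ (i choose 2) / qpoch r r i * x ^ i" for i
  have c_Suc: "c (Suc i) = - (r ^ i * x) / (1 - r * r ^ i) * c i" for i
    using qpoch_pos[OF r(2), of i] one_minus_mult_power_pos[OF r(2), of i]
    by (simp add: c_def qpoch_Suc numeral_2_eq_2 power_add field_simps)
  \<comment> \<open>This bounds the ratio of consecutive terms; as it tends to 0, the series
    converges for every x.\<close>
  have "(\<lambda>i. r ^ i * \<bar>x\<bar> / (1 - r)) \<longlonglongrightarrow> 0 * \<bar>x\<bar> / (1 - r)"
    using r by (intro tendsto_intros LIMSEQ_realpow_zero) auto
  then have "\<forall>\<^sub>F i in sequentially. r ^ i * \<bar>x\<bar> / (1 - r) < 1 / 2"
    by (rule order_tendstoD) simp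
  then obtain N where N: "\<And>i. i \<ge> N \<Longrightarrow> r ^ i * \<bar>x\<bar> / (1 - r) < 1 / 2"
    by (auto simp: eventually_sequentially)
  have "summable (\<lambda>i. norm (c i))"
  proof (rule summable_ratio_test[where c = "1/2" and N = N])
    fix i assume "i \<ge> N"
    have d: "1 - r \<le> 1 - r * r ^ i"
      using r by (simp add: mult_left_le power_le_one)
    have "\<bar>- (r ^ i * x) / (1 - r * r ^ i)\<bar> = r ^ i * \<bar>x\<bar> / (1 - r * r ^ i)"
      using r one_minus_mult_power_pos[OF r(2), of i] by (simp add: abs_mult abs_divide)
    also have "\<dots> \<le> r ^ i * \<bar>x\<bar> / (1 - r)"
      using r d by (intro divide_left_mono mult_pos_pos less_le_trans[OF _ d]) auto
    also have "\<dots> \<le> 1 / 2" using N[OF \<open>i \<ge> N\<close>] by simp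
    finally have "\<bar>- (r ^ i * x) / (1 - r * r ^ i)\<bar> * \<bar>c i\<bar> \<le> 1 / 2 * \<bar>c i\<bar>"
      by (rule mult_right_mono) simp
    then show "norm (norm (c (Suc i))) \<le> 1 / 2 * norm (norm (c i))"
      unfolding c_Suc abs_mult[symmetric] real_norm_def by (simp add: abs_mult)
  qed simp
  then show ?thesis by (simp only: c_def)
qed

text \<open>The recursion of the coefficients gives F(x) = (1 - x) F(r x). Iteration splits off
  \<open>qpoch x r n\<close>, and the remaining factor F(x r^n) tends to F(0) = 1 by
  continuity.\<close>

lemma Euler_suminf: "(\<Sum>i. (- 1) ^ i * r ^ (i choose 2) / qpoch r r i * x ^ i) = qpoch_inf x r"
proof -
  define c where "c i = (- 1) ^ i * r ^ (i choose 2) / qpoch r r i" for i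
  have summ: "summable (\<lambda>i. c i * x ^ i)" for x
    unfolding c_def by (rule summable_norm_cancel[OF Euler_summable])
  define F where "F x = (\<Sum>i. c i * x ^ i)" for x
  have c_Suc: "c (Suc i) * (1 - r ^ Suc i) = - (c i * r ^ i)" for i
    using qpoch_pos[OF r(2), of i] one_minus_mult_power_pos[OF r(2), of i]
    by (simp add: c_def qpoch_Suc numeral_2_eq_2 power_add)
  have F_step: "F x = (1 - x) * F (x * r)" for x
  proof -
    have s: "summable (\<lambda>i. c i * (1 - r ^ i) * x ^ i)"
      using summable_diff[OF summ[of x] summ[of "x * r"]] by (simp add: power_mult_distrib algebra_simps)
    have "F x - F (x * r) = (\<Sum>i. c i * (1 - r ^ i) * x ^ i)"
      unfolding F_def by (subst suminf_diff[OF summ summ]) (simp add: power_mult_distrib algebra_simps)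
    also have "\<dots> = (\<Sum>i. c (Suc i) * (1 - r ^ Suc i) * x ^ Suc i)"
      using suminf_split_head[OF s] by simp
    also have "\<dots> = (\<Sum>i. - x * (c i * (x * r) ^ i))"
      unfolding c_Suc by (simp add: power_mult_distrib mult_ac)
    also have "\<dots> = - x * F (x * r)"
      unfolding F_def by (rule suminf_mult[OF summ])
    finally show ?thesis by (simp add: algebra_simps)
  qed
  have F_iter: "F x = qpoch x r n * F (x * r ^ n)" for n
    by (induction n) (simp_all add: qpoch_Suc F_step[of "x * r ^ _"] mult_ac)
  have "isCont F 0"
    unfolding F_def[abs_def] by (rule isCont_powser_converges_everywhere[OF summ])
  moreover have "(\<lambda>n. x * r ^ n) \<longlonglongrightarrow> 0"
    using r by (intro tendsto_mult_right_zero LIMSEQ_realpow_zero) auto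
  ultimately have "(\<lambda>n. F (x * r ^ n)) \<longlonglongrightarrow> F 0"
    by (rule isCont_tendsto_compose)
  moreover have "F 0 = 1" by (simp only: F_def powser_zero) (simp add: c_def numeral_2_eq_2)
  ultimately have "(\<lambda>n. qpoch x r n * F (x * r ^ n)) \<longlonglongrightarrow> qpoch_inf x r * 1"
    by (intro tendsto_mult qpoch_tendsto) simp
  then have "F x = qpoch_inf x r"
    using F_iter by (simp add: LIMSEQ_const_iff flip: F_iter)
  then show ?thesis by (simp only: F_def c_def)
qed

section \<open>The terminating q-binomial theorem\<close>

text \<open>The case z = 1 of the sum of (r^(-m); r)_j / (r; r)_j z^j = (z r^(-m); r)_m, by
  induction on m with a q-Pascal rule.\<close>

lemma qpoch_binomial_sum:
  "(\<Sum>j\<le>m. qpoch (r powi (- int m)) r j / qpoch r r j) = qpoch (r powi (- int m)) r m"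
proof -
  have van: "qpoch (r powi (- int m)) r (Suc m) = 0" for m
    using r by (simp add: qpoch_Suc power_int_minus)
  \<comment> \<open>With u = r^(-m-1) the factor (u r; r)_j is common to all terms, and what remains
    is (1 - u r^(j+1)) - u (1 - r^(j+1)) = 1 - u.\<close>
  have pascal: "qpoch (r powi (- int (Suc m))) r (Suc j) / qpoch r r (Suc j)
      = qpoch (r powi (- int m)) r (Suc j) / qpoch r r (Suc j)
        - r powi (- int (Suc m)) * (qpoch (r powi (- int m)) r j / qpoch r r j)" for m j
  proof -
    have a: "r powi (- int m) = r powi (- int (Suc m)) * r"
      unfolding powi_minus_of_nat using r by (simp add: field_simps)
    define u where "u = r powi (- int (Suc m))"
    have p: "qpoch r r j \<noteq> 0" "1 - r * r ^ j \<noteq> 0"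
      using qpoch_pos[OF r(2), of j] one_minus_mult_power_pos[OF r(2), of j] by simp_all
    have "qpoch u r (Suc j) = (1 - u) * qpoch (u * r) r j" by (rule qpoch_Suc')
    then show ?thesis
      unfolding a u_def[symmetric] qpoch_Suc[of "u * r"] qpoch_Suc[of r] using p
      by (simp add: divide_simps) (simp add: algebra_simps)
  qed
  show ?thesis
  proof (induction m)
    case 0
    show ?case by simp
  next
    case (Suc m)
    have "(\<Sum>j\<le>Suc m. qpoch (r powi (- int (Suc m))) r j / qpoch r r j)
        = 1 + (\<Sum>j\<le>m. qpoch (r powi (- int (Suc m))) r (Suc j) / qpoch r r (Suc j))"
      by (simp only: sum.atMost_Suc_shift) simp
    also have "\<dots> = (1 + (\<Sum>j\<le>m. qpoch (r powi (- int m)) r (Suc j) / qpoch r r (Suc j)))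
        - r powi (- int (Suc m)) * (\<Sum>j\<le>m. qpoch (r powi (- int m)) r j / qpoch r r j)"
      unfolding pascal sum_subtractf sum_distrib_left by simp
    also have "1 + (\<Sum>j\<le>m. qpoch (r powi (- int m)) r (Suc j) / qpoch r r (Suc j))
        = (\<Sum>j\<le>Suc m. qpoch (r powi (- int m)) r j / qpoch r r j)"
      by (simp only: sum.atMost_Suc_shift) simp
    also have "\<dots> = qpoch (r powi (- int m)) r m"
      by (simp add: van Suc.IH)
    also have "\<dots> - r powi (- int (Suc m)) * (\<Sum>j\<le>m. qpoch (r powi (- int m)) r j / qpoch r r j)
        = (1 - r powi (- int (Suc m))) * qpoch (r powi (- int m)) r m"
      by (simp add: Suc.IH algebra_simps)
    also have "\<dots> = qpoch (r powi (- int (Suc m))) r (Suc m)"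
    proof -
      have a: "r powi (- int (Suc m)) * r = r powi (- int m)"
        unfolding powi_minus_of_nat using r by (simp add: field_simps)
      show ?thesis unfolding qpoch_Suc' a ..
    qed
    finally show ?case .
  qed
qed

text \<open>The factors are 1 - r^(-l) = - r^(-l) (1 - r^l) with l = 1, ..., m.\<close>

lemma qpoch_powi_self:
  "qpoch (r powi (- int m)) r m * r ^ (Suc m choose 2) = (- 1) ^ m * qpoch r r m"
proof (induction m)
  case 0
  then show ?case by (simp add: numeral_2_eq_2)
next
  case (Suc m)
  have a: "r powi (- int (Suc m)) * r = r powi (- int m)"
    and b: "(1 - r powi (- int (Suc m))) * r ^ Suc m = - (1 - r * r ^ m)"
    unfolding powi_minus_of_nat using r by (simp_all add: field_simps)
  have "qpoch (r powi (- int (Suc m))) r (Suc m) * r ^ (Suc (Suc m) choose 2)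
    = ((1 - r powi (- int (Suc m))) * r ^ Suc m) * (qpoch (r powi (- int m)) r m * r ^ (Suc m choose 2))"
    unfolding qpoch_Suc' a by (simp add: numeral_2_eq_2 power_add)
  then show ?case unfolding Suc.IH b by (simp add: qpoch_Suc algebra_simps)
qed

section \<open>The two limits of the rescaled series\<close>

text \<open>After the shift j = i + N the powers of r combine to r^(i choose 2) r^i, free of N. Then
  N enters only through (a; r)_j / (r; r)_j, which converges and hence is bounded, so Tannery's
  theorem applies.\<close>

lemma q_series_limit_pos:
  assumes a: "a < 1"
  shows "(\<lambda>N. (- 1) ^ N * r ^ (N choose 2) *
    (\<Sum>j. qpoch a r j * qpoch_inf (r powi (1 - int N) * r ^ j) r / qpoch r r j
         * (- 1) ^ j * r ^ (j choose 2) * (r powi (1 - int N)) ^ j))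
    \<longlonglongrightarrow> qpoch_inf a r * qpoch_inf r r"
proof -
  define f where "f N j = qpoch a r j * qpoch_inf (r powi (1 - int N) * r ^ j) r / qpoch r r j
         * (- 1) ^ j * r ^ (j choose 2) * (r powi (1 - int N)) ^ j" for N j
  define R where "R j = qpoch a r j / qpoch r r j" for j
  define g where "g i = (- 1) ^ i * r ^ (i choose 2) / qpoch r r i * r ^ i * qpoch_inf r r" for i
  have sg: "summable (\<lambda>i. norm (g i))"
    unfolding g_def norm_mult[of _ "qpoch_inf r r"] by (intro summable_mult2 Euler_summable)
  have R: "R \<longlonglongrightarrow> qpoch_inf a r / qpoch_inf r r"
    unfolding R_def using qpoch_inf_pos[OF r(2)] by (intro tendsto_divide qpoch_tendsto) auto
  then obtain K where K: "\<And>j. \<bar>R j\<bar> \<le> K"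
    using convergent_imp_Bseq[OF convergentI[OF R]] by (auto simp: Bseq_def)
  \<comment> \<open>The infinite product contains the factor of index N - 1 - j, whose power of r
    has exponent 0.\<close>
  have f0: "f N j = 0" if "j < N" for N j
  proof -
    have "r powi (1 - int N) * r ^ j * r ^ (N - 1 - j) = r powi (1 - int N + int j + int (N - 1 - j))"
      using r by (simp add: power_int_add)
    also have "\<dots> = 1" using that by (simp add: of_nat_diff)
    finally have "qpoch_inf (r powi (1 - int N) * r ^ j) r = 0" by (rule qpoch_inf_eq_0)
    then show ?thesis by (simp add: f_def)
  qed
  have fN: "(- 1) ^ N * r ^ (N choose 2) * f N (i + N) = R (i + N) * g i" for N i
  proof -
    have "r powi (1 - int N) * r ^ (i + N) = r powi (1 + int i)"
      by (subst power_int_of_nat[symmetric], subst power_int_add[symmetric]) (use r in auto)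
    then have 1: "r powi (1 - int N) * r ^ (i + N) = r * r ^ i"
      using r by (simp add: power_int_add)
    have 2: "qpoch_inf r r = qpoch r r i * qpoch_inf (r * r ^ i) r" by (rule qpoch_inf_split)
    have "r ^ (N choose 2) * r ^ ((i + N) choose 2) * (r powi (1 - int N)) ^ (i + N)
       = r powi (int (N choose 2) + int ((i + N) choose 2) + (1 - int N) * int (i + N))"
      using r by (simp add: power_int_add power_int_mult power_int_of_nat del: of_nat_add)
    also have "int (N choose 2) + int ((i + N) choose 2) + (1 - int N) * int (i + N)
       = int (i choose 2) + int i"
      using two_choose_two[of N] two_choose_two[of i] two_choose_two[of "i + N"]
      by (simp add: algebra_simps)
    also have "r powi \<dots> = r ^ (i choose 2) * r ^ i"
      using r by (simp add: power_int_add)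
    finally have 3: "r ^ (N choose 2) * r ^ ((i + N) choose 2) * (r powi (1 - int N)) ^ (i + N)
       = r ^ (i choose 2) * r ^ i" .
    have 4: "(- 1) ^ N * (- 1) ^ (i + N) = ((- 1) ^ i :: real)"
      by (simp add: power_add)
    have "(- 1) ^ N * r ^ (N choose 2) * f N (i + N) = R (i + N) * qpoch_inf (r * r ^ i) r
      * ((- 1) ^ N * (- 1) ^ (i + N)) * (r ^ (N choose 2) * r ^ ((i + N) choose 2) * (r powi (1 - int N)) ^ (i + N))"
      unfolding f_def R_def 1 by simp
    also have "\<dots> = R (i + N) * g i"
      unfolding 3 4 g_def 2 using qpoch_pos[OF r(2), of i] by simp
    finally show ?thesis .
  qed
  have lim: "(\<lambda>N. \<Sum>i. R (i + N) * g i) \<longlonglongrightarrow> (\<Sum>i. qpoch_inf a r / qpoch_inf r r * g i)"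
  proof -
    have "eventually (\<lambda>(i, N). norm (R (i + N) * g i) \<le> K * norm (g i)) (at_top \<times>\<^sub>F sequentially)"
      using K by (intro always_eventually) (auto simp: abs_mult intro: mult_right_mono)
    moreover have "(\<lambda>N. R (i + N) * g i) \<longlonglongrightarrow> qpoch_inf a r / qpoch_inf r r * g i" for i
      using LIMSEQ_ignore_initial_segment[OF R, of i] by (intro tendsto_mult tendsto_const) (simp add: add.commute)
    ultimately show ?thesis
      using tannerys_theorem[of "\<lambda>i N. R (i + N) * g i" "\<lambda>i. qpoch_inf a r / qpoch_inf r r * g i"
          sequentially "\<lambda>i. K * norm (g i)"] sg by (simp add: summable_mult)
  qed
  \<comment> \<open>One factor is Euler's series at x = r, the other is the constant carried by
    every \<open>g i\<close>.\<close>
  have sum_g: "(\<Sum>i. g i) = qpoch_inf r r * qpoch_inf r r"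
    unfolding g_def suminf_mult2[OF summable_norm_cancel[OF Euler_summable], symmetric] Euler_suminf ..
  have eq: "(\<Sum>i. R (i + N) * g i) = (- 1) ^ N * r ^ (N choose 2) * (\<Sum>j. f N j)" for N
  proof -
    have sR: "summable (\<lambda>i. R (i + N) * g i)"
      by (rule summable_comparison_test'[OF summable_mult[OF sg, of K]])
        (use K in \<open>auto simp: abs_mult intro: mult_right_mono\<close>)
    define e where "e = (- 1) ^ N * r ^ (N choose 2)"
    have e: "e \<noteq> 0" using r by (simp add: e_def)
    have "(\<lambda>i. e * f N (i + N)) sums (\<Sum>i. R (i + N) * g i)"
      using summable_sums[OF sR] unfolding e_def fN .
    \<comment> \<open>The shift back adds N zero terms by \<open>f0\<close>.\<close>
    then have "(\<lambda>i. e * f N i) sums (\<Sum>i. R (i + N) * g i)"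
      by (subst (asm) sums_zero_iff_shift) (simp_all add: f0)
    then have "(\<lambda>i. f N i) sums ((\<Sum>i. R (i + N) * g i) / e)"
      using e sums_mult_D by blast
    then have "(\<Sum>j. f N j) = (\<Sum>i. R (i + N) * g i) / e" by (simp add: sums_iff)
    then show ?thesis using e by (simp add: e_def[symmetric])
  qed
  have "(\<Sum>i. qpoch_inf a r / qpoch_inf r r * g i) = qpoch_inf a r * qpoch_inf r r"
    using qpoch_inf_pos[OF r(2)] by (subst suminf_mult[OF summable_norm_cancel[OF sg]]) (simp add: sum_g)
  then show ?thesis using lim unfolding eq f_def by simp
qed

text \<open>Terms with j > m contain the factor 1 - r^(-m) r^m, so a finite sum remains and limits
  are taken termwise. In each term the infinite product starts at -r^(-M) with M = N - 1 - j, and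
  its reflection uses up exactly the powers of r present. The limits are proportional to
  \<open>B j\<close>, which \<open>qpoch_binomial_sum\<close> adds up.\<close>

lemma q_series_limit_neg:
  "(\<lambda>N. r ^ (N choose 2) *
    (\<Sum>j. qpoch (r powi (- int m)) r j * qpoch_inf (- (r powi (1 - int N)) * r ^ j) r / qpoch r r j
         * (- 1) ^ j * r ^ (j choose 2) * (- (r powi (1 - int N))) ^ j))
    \<longlonglongrightarrow> 2 * (qpoch_inf (- r) r)\<^sup>2 * qpoch (r powi (- int m)) r m"
proof -
  define f where "f N j = qpoch (r powi (- int m)) r j * qpoch_inf (- (r powi (1 - int N)) * r ^ j) r / qpoch r r j
         * (- 1) ^ j * r ^ (j choose 2) * (- (r powi (1 - int N))) ^ j" for N j
  define P where "P = qpoch_inf (- r) r"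
  define B where "B j = qpoch (r powi (- int m)) r j / qpoch r r j" for j
  have f0: "f N j = 0" if "j \<notin> {..m}" for N j
  proof -
    have "m < j" using that by simp
    then obtain d where d: "j = Suc m + d" by (auto dest: less_imp_Suc_add)
    have "qpoch (r powi (- int m)) r j = 0"
      unfolding d qpoch_add using r by (simp add: qpoch_Suc power_int_minus)
    then show ?thesis by (simp add: f_def)
  qed
  have fin: "(\<Sum>j. f N j) = (\<Sum>j\<le>m. f N j)" for N
    by (rule suminf_finite) (auto simp: f0)
  have fN: "r ^ (N choose 2) * f N j = B j * (2 * qpoch (- r) r (N - 1 - j) * P)" if "j < N" for N j
  proof -
    define M where "M = N - 1 - j"
    have N: "N = Suc (M + j)" using that by (simp add: M_def)
    have 1: "- (r powi (1 - int N)) * r ^ j = - (r powi (- int M))"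
      using r by (simp add: N power_int_diff power_int_add power_int_minus field_simps)
    have 2: "(- (r powi (1 - int N))) ^ j = (- 1) ^ j * (r powi (1 - int N)) ^ j"
      by (rule power_minus)
    have "r ^ (N choose 2) * r ^ (j choose 2) * (r powi (1 - int N)) ^ j
       = r powi (int (N choose 2) + int (j choose 2) + (1 - int N) * int j)"
      using r by (simp add: power_int_add power_int_mult power_int_of_nat)
    also have "int (N choose 2) + int (j choose 2) + (1 - int N) * int j = int (Suc M choose 2)"
      using two_choose_two[of N] two_choose_two[of j] two_choose_two[of "Suc M"]
      by (simp add: N algebra_simps)
    finally have 3: "r ^ (N choose 2) * r ^ (j choose 2) * (r powi (1 - int N)) ^ j = r ^ (Suc M choose 2)"
      by simp
    \<comment> \<open>One sign belongs to the series, the other to its negative argument.\<close>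
    have 4: "(- 1) ^ j * (- 1) ^ j = (1::real)" by (simp flip: power_mult_distrib)
    have "r ^ (N choose 2) * f N j = B j * qpoch_inf (- (r powi (- int M))) r * ((- 1) ^ j * (- 1) ^ j)
        * (r ^ (N choose 2) * r ^ (j choose 2) * (r powi (1 - int N)) ^ j)"
      unfolding f_def 1 2 B_def by simp
    also have "\<dots> = B j * (r ^ (Suc M choose 2) * qpoch_inf (- (r powi (- int M))) r)"
      unfolding 3 4 by simp
    also have "\<dots> = B j * (2 * qpoch (- r) r M * P)"
      by (simp only: qpoch_inf_minus_powi P_def)
    finally show ?thesis by (simp only: M_def)
  qed
  have "(\<lambda>N. r ^ (N choose 2) * f N j) \<longlonglongrightarrow> B j * (2 * P * P)" for j
  proof (rule Lim_transform_eventually)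
    have "(\<lambda>N. qpoch (- r) r (N - 1 - j)) \<longlonglongrightarrow> P"
      using LIMSEQ_offset[where k = "Suc j" and f = "\<lambda>N. qpoch (- r) r (N - 1 - j)"]
        qpoch_tendsto[of "- r"] by (simp add: P_def)
    then show "(\<lambda>N. B j * (2 * qpoch (- r) r (N - 1 - j) * P)) \<longlonglongrightarrow> B j * (2 * P * P)"
      by (intro tendsto_intros)
    show "\<forall>\<^sub>F N in sequentially. B j * (2 * qpoch (- r) r (N - 1 - j) * P) = r ^ (N choose 2) * f N j"
      using eventually_gt_at_top[of j] by eventually_elim (rule fN[symmetric])
  qed
  then have "(\<lambda>N. \<Sum>j\<le>m. r ^ (N choose 2) * f N j) \<longlonglongrightarrow> (\<Sum>j\<le>m. B j * (2 * P * P))"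
    by (intro tendsto_sum)
  moreover have "(\<Sum>j\<le>m. B j * (2 * P * P)) = 2 * P\<^sup>2 * qpoch (r powi (- int m)) r m"
    unfolding sum_distrib_right[symmetric] B_def qpoch_binomial_sum by (simp add: power2_eq_square)
  ultimately have "(\<lambda>N. r ^ (N choose 2) * (\<Sum>j. f N j)) \<longlonglongrightarrow> 2 * P\<^sup>2 * qpoch (r powi (- int m)) r m"
    by (simp only: fin sum_distrib_left)
  then show ?thesis unfolding f_def P_def .
qed

end

section \<open>The limit of \<open>a\<^sub>t(q\<^bsup>-n\<^esup>, t)\<close>\<close>

text \<open>All factorials have base q^2, and q^(n (n - 1)) = (q^2)^(n choose 2) is the Gaussian
  factor for that base. In this form the two limits above apply.\<close>

lemma Psi_eq:
  "Psi q a b z = (\<Sum>j. qpoch a (q\<^sup>2) j * qpoch_inf (b * (q\<^sup>2) ^ j) (q\<^sup>2) / qpoch (q\<^sup>2) (q\<^sup>2) j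
     * (- 1) ^ j * (q\<^sup>2) ^ (j choose 2) * z ^ j)"
proof -
  have "n * (n - 1) = 2 * (n choose 2)" for n :: nat
    by (cases n) (simp_all add: choose_two)
  then show ?thesis by (simp add: Psi_def power_mult)
qed

context
  fixes q :: real
  assumes q: "0 < q" "q < 1"
begin

lemma q_squared_bounds: "0 < q\<^sup>2" "q\<^sup>2 < 1"
  using q by (simp_all add: power_strict_decreasing[of 0 2 q, simplified] power_less_one_iff)

lemma c_q_normalisation:
  "c_q q * q * sqrt 2 * qpoch_inf (- (q\<^sup>2)) (q\<^sup>2) * qpoch_inf (q\<^sup>2) (q\<^sup>2) = 1"
  using q qpoch_inf_pos[OF q_squared_bounds, of "q\<^sup>2"] qpoch_inf_pos[OF q_squared_bounds, of "- (q\<^sup>2)"] q_squared_bounds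
  by (simp add: c_q_def field_simps)

lemma powi_squared: "(x powi k)\<^sup>2 = (x\<^sup>2) powi k" for x :: real
  by (simp add: power2_eq_square power_int_mult_distrib)

text \<open>
  With \<open>N = n + k\<close>, the powers of \<open>q\<close> in \<open>\<nu>(t\<^sup>2 / q\<^bsup>-n\<^esup>)\<close> and in the square root of \<open>(-q\<^bsup>-2n\<^esup>; q\<^sup>2)\<^sub>\<infinity>\<close>
  combine to \<open>q\<^bsup>(k-1)(k-1) + N(N-1)\<^esup>\<close>, which is why \<open>\<Psi>\<close> is rescaled by \<open>q\<^bsup>N(N-1)\<^esup>\<close>.
\<close>

lemma a_coeff_tendsto_if_Psi_tendsto:
  fixes t :: real and k :: int and sg :: "nat \<Rightarrow> real"
  defines "Q \<equiv> q\<^sup>2"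
  assumes t: "\<bar>t\<bar> = q powi k"
    and A: "0 \<le> qpoch_inf (- kappa t) Q"
    and sg: "\<And>n. int n + k \<ge> 0 \<Longrightarrow>
      s_sign (q powi (- int n)) t * (- 1) powi k * (- sgn t) powi (- int n) = sg (nat (int n + k))"
    and X: "(\<lambda>N. sg N * Q ^ (N choose 2) *
      Psi q (- Q / kappa t) (sgn t * Q powi (1 - int N)) (sgn t * Q powi (1 - int N))) \<longlonglongrightarrow> X"
    and AX: "Q powr (real_of_int (k * (k - 1)) / 2) * (qpoch_inf (- kappa t) Q * X)
      = 2 * (qpoch_inf (- Q) Q)\<^sup>2 * qpoch_inf Q Q"
  shows "(\<lambda>n. a_coeff q t (q powi (- int n)) t) \<longlonglongrightarrow> 1"
proof -
  define A where "A = qpoch_inf (- kappa t) Q"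
  define P where "P = qpoch_inf (- Q) Q"
  define Y where "Y N = sg N * Q ^ (N choose 2) *
      Psi q (- Q / kappa t) (sgn t * Q powi (1 - int N)) (sgn t * Q powi (1 - int N))" for N
  note Q = q_squared_bounds[folded Q_def]
  have P: "P > 0" unfolding P_def using Q by (intro qpoch_inf_pos[OF Q]) auto
  \<comment> \<open>This is a_t(q^(-n), t) after reflecting the infinite product in the denominator
    under the root. The two agree once n + k >= 0, that is, when N is a natural number.\<close>
  define h where "h n = c_q q * \<bar>t\<bar> * A * q powr real_of_int ((k - 1)\<^sup>2) * Y (nat (int n + k))
      / sqrt (2 * qpoch (- Q) Q n * P)" for n
  have a_eq: "a_coeff q t (q powi (- int n)) t = h n" if n: "int n + k \<ge> 0" for n
  proof -
    define x where "x = q powi (- int n)"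
    define N where "N = nat (int n + k)"
    have N: "int N = int n + k" using n by (simp add: N_def)
    have x: "x > 0" using q by (simp add: x_def)
    have chix: "chi q x = - int n"
      by (rule chi_eq(1)[OF q]) (use q in \<open>simp add: x_def\<close>)
    have chit: "chi q t = k"
      by (rule chi_eq(1)[OF q t])
    have q0: "q \<noteq> 0" using q by simp
    have absx: "\<bar>x\<bar> = q powi (- int n)" using x by (simp add: x_def)
    have "2 * k + int n = k + k - (- int n)" by simp
    then have "\<bar>t * t / x\<bar> = q powi (2 * k + int n)"
      by (simp only: abs_divide abs_mult t absx power_int_add power_int_diff q0 simp_thms)
    then have "chi q (t * t / x) = 2 * k + int n" by (rule chi_eq(1)[OF q])
    then have nu: "nu q (t * t / x) = q powr (real_of_int ((2 * k + int n - 1) * (2 * k + int n - 2)) / 2)"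
      by (simp add: nu_def)
    have "(x / t)\<^sup>2 = (q powi (- int N))\<^sup>2"
    proof -
      have "- int N = - int n - k" using N by simp
      then have "\<bar>x / t\<bar> = q powi (- int N)"
        by (simp only: abs_divide t absx power_int_diff q0 simp_thms)
      then show ?thesis by (metis power2_abs)
    qed
    then have "Q * kappa (x / t) = sgn t * (q\<^sup>2 * (q powi (- int N))\<^sup>2)"
      using x by (simp add: kappa_def Q_def sgn_divide sgn_mult field_simps)
    also have "q\<^sup>2 * (q powi (- int N))\<^sup>2 = Q powi (1 - int N)"
      unfolding powi_squared using q0 by (simp add: Q_def power_int_diff power_int_minus divide_inverse)
    finally have kx: "Q * kappa (x / t) = sgn t * Q powi (1 - int N)" .
    have kap: "kappa x = Q powi (- int n)"
      using x by (simp add: kappa_def) (simp add: x_def Q_def powi_squared)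
    define B where "B = qpoch_inf (- kappa x) Q"
    define D where "D = 2 * qpoch (- Q) Q n * P"
    have D: "D > 0" unfolding D_def using P Q by (intro mult_pos_pos qpoch_pos[OF Q]) auto
    have B: "B = D / Q ^ (Suc n choose 2)"
      using qpoch_inf_minus_powi[OF Q, of n] Q unfolding B_def D_def P_def kap
      by (simp add: field_simps)
    have "sqrt (Q ^ (Suc n choose 2)) = q ^ (Suc n choose 2)"
      using q by (simp add: Q_def real_sqrt_power)
    \<comment> \<open>In a_t(x, t) both p and y equal t, so the numerator under the root is the
      square of \<open>A\<close>, and \<open>A\<close> is nonnegative.\<close>
    then have sq: "sqrt (A * A / B) = A * q ^ (Suc n choose 2) / sqrt D"
      using A[folded A_def] D Q by (simp add: B real_sqrt_divide real_sqrt_mult)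
    have pw: "nu q (t * t / x) * q ^ (Suc n choose 2) = q powr real_of_int ((k - 1)\<^sup>2) * Q ^ (N choose 2)"
    proof -
      have "nu q (t * t / x) * q ^ (Suc n choose 2)
         = q powr (real_of_int ((2 * k + int n - 1) * (2 * k + int n - 2)) / 2 + real (Suc n choose 2))"
        using q by (simp add: nu powr_add powr_realpow)
      also have "real (Suc n choose 2) = real_of_int (int n * (int n + 1)) / 2"
        using arg_cong[OF two_choose_two[of "Suc n"], of real_of_int] by (simp add: field_simps)
      also have "real_of_int ((2 * k + int n - 1) * (2 * k + int n - 2)) / 2 + \<dots>
         = real_of_int ((k - 1)\<^sup>2) + real_of_int (int N * (int N - 1))"
        by (simp add: N power2_eq_square field_simps)
      also have "int N * (int N - 1) = int (2 * (N choose 2))"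
        using two_choose_two[of N] by simp
      also have "q powr (real_of_int ((k - 1)\<^sup>2) + real_of_int (int (2 * (N choose 2))))
         = q powr real_of_int ((k - 1)\<^sup>2) * Q ^ (N choose 2)"
        unfolding powr_add of_int_of_nat_eq powr_realpow[OF q(1)] Q_def power_mult ..
      finally show ?thesis .
    qed
    have "a_coeff q t x t = c_q q * (s_sign x t * (- 1) powi k * (- sgn t) powi (- int n)) * \<bar>t\<bar>
       * (nu q (t * t / x) * q ^ (Suc n choose 2)) * A / sqrt D
       * Psi q (- Q / kappa t) (sgn t * Q powi (1 - int N)) (sgn t * Q powi (1 - int N))"
      using x sq unfolding A_def B_def by (simp add: a_coeff_def chix chit kx Q_def[symmetric] sgn_mult)
    also have "\<dots> = c_q q * \<bar>t\<bar> * A * q powr real_of_int ((k - 1)\<^sup>2) * Y N / sqrt D"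
      unfolding pw Y_def sg[OF n, folded x_def N_def] by (simp only: mult_ac times_divide_eq_left times_divide_eq_right)
    finally show ?thesis by (simp add: h_def N_def D_def x_def)
  qed
  have NN: "filterlim (\<lambda>n. nat (int n + k)) sequentially sequentially"
    unfolding filterlim_at_top eventually_sequentially
  proof
    fix Z :: nat
    show "\<exists>N. \<forall>n\<ge>N. Z \<le> nat (int n + k)"
      by (intro exI[of _ "Z + nat \<bar>k\<bar>"]) auto
  qed
  have "h \<longlonglongrightarrow> c_q q * \<bar>t\<bar> * A * q powr real_of_int ((k - 1)\<^sup>2) * X / sqrt (2 * P * P)"
    unfolding h_def using P
    by (intro tendsto_intros filterlim_compose[OF X[folded Y_def] NN] qpoch_tendsto[OF Q, folded P_def])
       (simp_all add: P_def qpoch_tendsto[OF Q])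
  moreover have "c_q q * \<bar>t\<bar> * A * q powr real_of_int ((k - 1)\<^sup>2) * X / sqrt (2 * P * P) = 1"
  proof -
    have "Q powr (real_of_int (k * (k - 1)) / 2) = q powr real_of_int (k * (k - 1))"
      using q by (simp add: Q_def powr_powr flip: powr_numeral)
    with AX have AX': "q powr real_of_int (k * (k - 1)) * (A * X) = 2 * P\<^sup>2 * qpoch_inf Q Q"
      by (simp add: A_def P_def)
    \<comment> \<open>Since k + (k - 1)^2 = 1 + k (k - 1), the factor |t| produces the exponent in
      \<open>AX\<close>, and the extra q cancels the one in \<open>c_q\<close>.\<close>
    have "\<bar>t\<bar> * q powr real_of_int ((k - 1)\<^sup>2) = q powr (real_of_int k + real_of_int ((k - 1)\<^sup>2))"
      using q by (simp add: t powr_add powr_real_of_int')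
    also have "real_of_int k + real_of_int ((k - 1)\<^sup>2) = 1 + real_of_int (k * (k - 1))"
      by (simp add: power2_eq_square algebra_simps)
    also have "q powr \<dots> = q * q powr real_of_int (k * (k - 1))"
      using q by (simp add: powr_add)
    finally have tq: "\<bar>t\<bar> * q powr real_of_int ((k - 1)\<^sup>2) = q * q powr real_of_int (k * (k - 1))" .
    have "c_q q * \<bar>t\<bar> * A * q powr real_of_int ((k - 1)\<^sup>2) * X
       = c_q q * (\<bar>t\<bar> * q powr real_of_int ((k - 1)\<^sup>2)) * (A * X)"
      by (simp only: mult_ac)
    also have "\<dots> = c_q q * q * (q powr real_of_int (k * (k - 1)) * (A * X))"
      unfolding tq by (simp only: mult_ac)
    also have "\<dots> = (c_q q * q * sqrt 2 * P * qpoch_inf Q Q) * (sqrt 2 * P)"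
      unfolding AX' power2_eq_square by simp
    also have "\<dots> = sqrt 2 * P"
      using c_q_normalisation unfolding P_def Q_def by simp
    finally show ?thesis using P by (simp add: real_sqrt_mult)
  qed
  ultimately have "h \<longlonglongrightarrow> 1" by (simp only:)
  moreover have "\<forall>\<^sub>F n in sequentially. h n = a_coeff q t (q powi (- int n)) t"
    unfolding eventually_sequentially by (intro exI[of _ "nat \<bar>k\<bar>"]) (auto simp: a_eq)
  ultimately show ?thesis by (rule Lim_transform_eventually)
qed

text \<open>The sign of t decides which identity closes the computation. For t > 0 the products at
  -kappa(t) and -q^2/kappa(t) form the theta product of \<open>qpoch_inf_theta\<close>. For t =
  -q^(m+1) the finite product in the limit turns into (q^2; q^2)_m by
  \<open>qpoch_powi_self\<close>, which completes the product at -kappa(t) = q^(2m+2) to (q^2;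
  q^2)_inf.\<close>

lemma a_coeff_tendsto_1:
  assumes "t \<in> Iq q"
  shows "(\<lambda>n. a_coeff q t (q powi (- int n)) t) \<longlonglongrightarrow> 1"
proof -
  consider k where "t = q powi k" | m where "t = - (q ^ Suc m)"
    using assms unfolding Iq_def by (auto simp del: power_Suc) (metis Suc_pred not_one_le_zero not_gr_zero One_nat_def)
  then show ?thesis
  proof cases
    case 1
    have t: "t > 0" using q 1 by simp
    have "kappa t = t\<^sup>2" using t by (simp add: kappa_def)
    then have kap: "kappa t = (q\<^sup>2) powi k" by (simp add: 1 powi_squared)
    have a: "- (q\<^sup>2) / kappa t = - ((q\<^sup>2) powi (1 - k))"
      unfolding kap using q by (simp add: power_int_diff)
    show ?thesis
    proof (rule a_coeff_tendsto_if_Psi_tendsto[where k = k and sg = "\<lambda>N. (- 1) ^ N"])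
      show "0 \<le> qpoch_inf (- kappa t) (q\<^sup>2)"
        unfolding kap using q by (intro less_imp_le qpoch_inf_pos[OF q_squared_bounds]) (simp add: order_less_trans[of _ 0])
      show "s_sign (q powi (- int n)) t * (- 1) powi k * (- sgn t) powi (- int n) = (- 1) ^ nat (int n + k)"
        if "int n + k \<ge> 0" for n
      proof -
        have "(- 1 :: real) ^ nat (int n + k) = (- 1) powi (int n + k)"
          using that by (simp add: power_int_def)
        then show ?thesis
          using t by (simp add: s_sign_def power_int_add power_int_minus mult.commute flip: power_inverse)
      qed
      show "(\<lambda>N. (- 1) ^ N * (q\<^sup>2) ^ (N choose 2) *
          Psi q (- (q\<^sup>2) / kappa t) (sgn t * (q\<^sup>2) powi (1 - int N)) (sgn t * (q\<^sup>2) powi (1 - int N)))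
        \<longlonglongrightarrow> qpoch_inf (- (q\<^sup>2) / kappa t) (q\<^sup>2) * qpoch_inf (q\<^sup>2) (q\<^sup>2)"
      proof -
        have "- (q\<^sup>2) / kappa t < 1"
          unfolding a using q by (simp add: order_less_trans[of _ 0])
        from q_series_limit_pos[OF q_squared_bounds this] t show ?thesis
          by (simp only: Psi_eq sgn_pos mult_1_left)
      qed
      show "(q\<^sup>2) powr (real_of_int (k * (k - 1)) / 2) *
          (qpoch_inf (- kappa t) (q\<^sup>2) * (qpoch_inf (- (q\<^sup>2) / kappa t) (q\<^sup>2) * qpoch_inf (q\<^sup>2) (q\<^sup>2)))
        = 2 * (qpoch_inf (- (q\<^sup>2)) (q\<^sup>2))\<^sup>2 * qpoch_inf (q\<^sup>2) (q\<^sup>2)"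
        using qpoch_inf_theta[OF q_squared_bounds, of k] unfolding a unfolding kap by (simp only: mult.assoc[symmetric])
    qed (use q in \<open>simp add: 1\<close>)
  next
    case 2
    have t: "t < 0" using q 2 by simp
    have kap: "kappa t = - ((q\<^sup>2) ^ Suc m)"
      using t q by (simp add: kappa_def 2 flip: power_mult del: power_Suc)
        (simp add: mult.commute power_add power2_eq_square)
    have a: "- (q\<^sup>2) / kappa t = (q\<^sup>2) powi (- int m)"
      unfolding kap using q by (simp add: power_int_minus field_simps)
    show ?thesis
    proof (rule a_coeff_tendsto_if_Psi_tendsto[where k = "int (Suc m)" and sg = "\<lambda>N. (- 1) ^ m"])
      show "0 \<le> qpoch_inf (- kappa t) (q\<^sup>2)"
        unfolding kap using q_squared_bounds
        by (intro less_imp_le qpoch_inf_pos[OF q_squared_bounds]) (simp add: power_less_one_iff del: power_Suc)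
      \<comment> \<open>Here s(x, t) = -1, which lowers the exponent of the sign from m + 1 to
        m.\<close>
      show "s_sign (q powi (- int n)) t * (- 1) powi int (Suc m) * (- sgn t) powi (- int n) = (- 1) ^ m"
        if "int n + int (Suc m) \<ge> 0" for n
        using t q unfolding power_int_of_nat by (simp add: s_sign_def)
      show "(\<lambda>N. (- 1) ^ m * (q\<^sup>2) ^ (N choose 2) *
          Psi q (- (q\<^sup>2) / kappa t) (sgn t * (q\<^sup>2) powi (1 - int N)) (sgn t * (q\<^sup>2) powi (1 - int N)))
        \<longlonglongrightarrow> (- 1) ^ m * (2 * (qpoch_inf (- (q\<^sup>2)) (q\<^sup>2))\<^sup>2 * qpoch ((q\<^sup>2) powi (- int m)) (q\<^sup>2) m)"
        using tendsto_mult[OF tendsto_const q_series_limit_neg[OF q_squared_bounds], of "(- 1) ^ m" m] t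
        by (simp only: Psi_eq a sgn_neg mult_minus1 mult.assoc)
      have e: "(q\<^sup>2) powr (real_of_int (int (Suc m) * (int (Suc m) - 1)) / 2) = (q\<^sup>2) ^ (Suc m choose 2)"
        using two_choose_two[of "Suc m", symmetric] q powr_realpow[OF q_squared_bounds(1), of "Suc m choose 2"]
        by (simp only:) simp
      show "(q\<^sup>2) powr (real_of_int (int (Suc m) * (int (Suc m) - 1)) / 2) *
          (qpoch_inf (- kappa t) (q\<^sup>2) * ((- 1) ^ m * (2 * (qpoch_inf (- (q\<^sup>2)) (q\<^sup>2))\<^sup>2 * qpoch ((q\<^sup>2) powi (- int m)) (q\<^sup>2) m)))
        = 2 * (qpoch_inf (- (q\<^sup>2)) (q\<^sup>2))\<^sup>2 * qpoch_inf (q\<^sup>2) (q\<^sup>2)"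
      proof -
        have 1: "(- 1) ^ m * (- 1) ^ m = (1 :: real)" by (simp flip: power_mult_distrib)
        have 2: "qpoch_inf (q\<^sup>2) (q\<^sup>2) = qpoch (q\<^sup>2) (q\<^sup>2) m * qpoch_inf (- kappa t) (q\<^sup>2)"
          using qpoch_inf_split[OF q_squared_bounds, of "q\<^sup>2" m] by (simp add: kap)
        have "(q\<^sup>2) ^ (Suc m choose 2) *
          (qpoch_inf (- kappa t) (q\<^sup>2) * ((- 1) ^ m * (2 * (qpoch_inf (- (q\<^sup>2)) (q\<^sup>2))\<^sup>2 * qpoch ((q\<^sup>2) powi (- int m)) (q\<^sup>2) m)))
          = 2 * (qpoch_inf (- (q\<^sup>2)) (q\<^sup>2))\<^sup>2 * (qpoch_inf (- kappa t) (q\<^sup>2) * ((- 1) ^ m *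
            (qpoch ((q\<^sup>2) powi (- int m)) (q\<^sup>2) m * (q\<^sup>2) ^ (Suc m choose 2))))"
          by (simp only: mult_ac)
        also have "\<dots> = 2 * (qpoch_inf (- (q\<^sup>2)) (q\<^sup>2))\<^sup>2 * (((- 1) ^ m * (- 1) ^ m) * (qpoch (q\<^sup>2) (q\<^sup>2) m * qpoch_inf (- kappa t) (q\<^sup>2)))"
          unfolding qpoch_powi_self[OF q_squared_bounds] by (simp only: mult_ac)
        finally show ?thesis unfolding e 1 2 by simp
      qed
    qed (use q in \<open>simp add: 2 del: power_Suc of_nat_Suc\<close>)
  qed
qed

end

section \<open>Almost invariant vectors and coamenability\<close>

lemma cinner_diff_left: "cinner (x - y) z = cinner x z - cinner y z"
  using cinner_add_left[of "x - y" y z] by simp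

lemma cinner_zero_left [simp]: "cinner 0 y = 0"
  using cinner_add_left[of 0 0 y] by simp

lemma cinner_zero_right [simp]: "cinner x 0 = 0"
  using cinner_add_right[of x 0 0] by simp

lemma cinner_sum_left: "cinner (\<Sum>i\<in>F. f i) y = (\<Sum>i\<in>F. cinner (f i) y)"
  by (induction F rule: infinite_finite_induct) (simp_all add: cinner_add_left)

lemma cinner_sum_right: "cinner x (\<Sum>i\<in>F. f i) = (\<Sum>i\<in>F. cinner x (f i))"
  by (induction F rule: infinite_finite_induct) (simp_all add: cinner_add_right)

lemma cinner_ket_right: "cinner x (ket i) = coord x i"
proof -
  have "((\<lambda>j. coord x j * cnj (coord (ket i) j)) has_sum coord x i) UNIV \<longleftrightarrow>
      ((\<lambda>j. coord x j * cnj (coord (ket i) j)) has_sum coord x i) {i}"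
    by (rule has_sum_cong_neutral) (auto simp: ket.rep_eq)
  also have "\<dots>" by (rule has_sum_finiteI) (simp_all add: ket.rep_eq)
  finally show ?thesis by (simp add: cinner.rep_eq infsumI)
qed

lemma coord_ket: "coord (ket i) j = (if j = i then 1 else 0)"
  by (simp add: ket.rep_eq)

lemma norm_ket [simp]: "norm (ket i) = 1"
proof -
  have "complex_of_real ((norm (ket i))\<^sup>2) = 1"
    by (simp only: cinner_self_norm[symmetric] cinner_ket_right coord_ket) simp
  then have "(norm (ket i))\<^sup>2 = 1" by (simp only: of_real_eq_1_iff)
  then show ?thesis by (simp add: power2_eq_1_iff) (metis norm_ge_zero not_one_le_zero one_neq_neg_one neg_0_le_iff_le)
qed

lemma tensor_ket: "ket i \<otimes>\<^sub>2 ket j = ket (i, j)"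
  by (rule ell2_eqI) (auto simp: tensor.rep_eq coord_ket split: if_splits)

lemma tensor_diff_right: "x \<otimes>\<^sub>2 (y - z) = x \<otimes>\<^sub>2 y - x \<otimes>\<^sub>2 z"
  using tensor_add_right[of x "y - z" z] by simp

lemma tensor_sum_left: "(\<Sum>i\<in>F. f i) \<otimes>\<^sub>2 y = (\<Sum>i\<in>F. f i \<otimes>\<^sub>2 y)"
proof -
  have "0 \<otimes>\<^sub>2 y = 0" by (rule ell2_eqI) (simp add: tensor.rep_eq case_prod_unfold)
  then show ?thesis
    by (induction F rule: infinite_finite_induct) (simp_all add: tensor_add_left)
qed

lemma tensor_sum_right: "x \<otimes>\<^sub>2 (\<Sum>i\<in>F. f i) = (\<Sum>i\<in>F. x \<otimes>\<^sub>2 f i)"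
proof -
  have "x \<otimes>\<^sub>2 0 = 0" by (rule ell2_eqI) (simp add: tensor.rep_eq case_prod_unfold)
  then show ?thesis
    by (induction F rule: infinite_finite_induct) (simp_all add: tensor_add_right)
qed

lemma cinner_tensor: "cinner (x \<otimes>\<^sub>2 u) (y \<otimes>\<^sub>2 v) = cinner x y * cinner u v"
proof -
  let ?f = "\<lambda>(i, j). (coord x i * cnj (coord y i)) * (coord u j * cnj (coord v j))"
  have eq: "coord (x \<otimes>\<^sub>2 u) k * cnj (coord (y \<otimes>\<^sub>2 v) k) = ?f k" for k
    by (simp add: tensor.rep_eq case_prod_unfold)
  have summ: "?f summable_on UNIV \<times> UNIV"
    using summable_cinner'[of "x \<otimes>\<^sub>2 u" "y \<otimes>\<^sub>2 v"] by (simp add: eq)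
  have "cinner (x \<otimes>\<^sub>2 u) (y \<otimes>\<^sub>2 v) = infsum ?f (UNIV \<times> UNIV)"
    by (simp add: cinner.rep_eq eq)
  also have "\<dots> = (\<Sum>\<^sub>\<infinity>i. \<Sum>\<^sub>\<infinity>j. (coord x i * cnj (coord y i)) * (coord u j * cnj (coord v j)))"
    using infsum_Sigma'_banach[OF summ] by simp
  also have "\<dots> = cinner x y * cinner u v"
    by (simp add: cinner.rep_eq infsum_cmult_right' infsum_cmult_left')
  finally show ?thesis .
qed

lemma norm_diff_power2: "(norm (x - y))\<^sup>2 = (norm x)\<^sup>2 + (norm y)\<^sup>2 - 2 * Re (cinner x y)" for x y :: "'i ell2"
  by (simp add: power2_norm_eq_inner inner_diff_left inner_diff_right inner_commute)
     (simp add: inner_ell2_def)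

lemma unitary_cancel:
  assumes "unitary U"
  shows "blinfun_apply (cadj U) (blinfun_apply U x) = x"
    and "blinfun_apply U (blinfun_apply (cadj U) y) = y"
  using assms by (auto simp: unitary_def simp flip: blinfun_apply_blinfun_compose)

lemma norm_unitary:
  assumes "unitary U"
  shows "norm (blinfun_apply U x) = norm x" and "norm (blinfun_apply (cadj U) y) = norm y"
proof -
  have U: "U \<in> Bop" using assms by (simp add: unitary_def)
  have "cinner (blinfun_apply U x) (blinfun_apply U x) = cinner x x"
    using cinner_cadj[OF U, of "blinfun_apply U x" x] by (simp add: unitary_cancel[OF assms])
  then have "(norm (blinfun_apply U x))\<^sup>2 = (norm x)\<^sup>2"
    unfolding cinner_self_norm of_real_eq_iff .
  then show "norm (blinfun_apply U x) = norm x" by simp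
  have "cinner (blinfun_apply (cadj U) y) (blinfun_apply (cadj U) y) = cinner y y"
    using cinner_cadj[OF U, of y "blinfun_apply (cadj U) y"] by (simp add: unitary_cancel[OF assms])
  then have "(norm (blinfun_apply (cadj U) y))\<^sup>2 = (norm y)\<^sup>2"
    unfolding cinner_self_norm of_real_eq_iff .
  then show "norm (blinfun_apply (cadj U) y) = norm y" by simp
qed

text \<open>Places the norm closure \<open>C0 W\<close> inside \<open>Bop\<close>, where
  \<open>cadj\<close> has the defining property of the adjoint.\<close>

lemma closed_Bop: "closed Bop"
proof -
  have "bounded_linear (\<lambda>x::'j ell2. c *\<^sub>C x)" for c
    by (rule bounded_linear_intro[where K = "cmod c"]) (auto intro!: ell2_eqI simp: algebra_simps)
  note scale = bounded_linear.continuous_on[OF this]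
  have "continuous_on UNIV (\<lambda>T::'i ell2 \<Rightarrow>\<^sub>L 'j ell2. blinfun_apply T x)" for x
    by (rule linear_continuous_on[OF blinfun.bounded_linear_left])
  then show ?thesis
    unfolding Bop_def by (intro closed_Collect_all closed_Collect_eq scale)
qed

lemma vector_state_predual: "(\<lambda>T. cinner (blinfun_apply T u) u) \<in> predual"
proof -
  define \<xi> :: "nat \<Rightarrow> 'a ell2" where "\<xi> n = (if n = 0 then u else 0)" for n
  have "(\<lambda>n. (norm (\<xi> n))\<^sup>2) = (\<lambda>n. if n = 0 then (norm u)\<^sup>2 else 0)" by (auto simp: \<xi>_def)
  then have "summable (\<lambda>n. (norm (\<xi> n))\<^sup>2)" by simp
  moreover have "(\<Sum>n. cinner (blinfun_apply T (\<xi> n)) (\<xi> n)) = cinner (blinfun_apply T u) u" for T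
    using suminf_finite[of "{0}" "\<lambda>n. cinner (blinfun_apply T (\<xi> n)) (\<xi> n)"] by (simp add: \<xi>_def)
  ultimately show ?thesis unfolding predual_def by (auto intro!: exI[of _ \<xi>])
qed

lemma norm_blinfun_le_form:
  assumes "K \<ge> 0" and "\<And>x y. cmod (cinner (blinfun_apply T x) y) \<le> K * norm x * norm y"
  shows "norm T \<le> K"
proof (rule norm_blinfun_bound[OF assms(1)])
  fix x
  define r where "r = blinfun_apply T x"
  have "cmod (cinner r r) = norm r * norm r"
    by (simp add: cinner_self_norm norm_power power2_eq_square norm_mult)
  then have "norm r * norm r \<le> (K * norm x) * norm r"
    using assms(2)[of x r] by (simp add: r_def)
  then show "norm (blinfun_apply T x) \<le> K * norm x"
    using assms(1) by (cases "norm r = 0") (auto simp: r_def[symmetric])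
qed

section \<open>From almost invariant vectors to the counit\<close>

text \<open>The slices are bounded by \<open>norm W\<close>. As \<open>\<xi> n\<close> is a unit
  vector, <u, v> is the inner product of its tensors with u and v, so \<open>inv\<close> makes the
  matrix coefficients of the slices converge. A normal functional is a series of such coefficients,
  and Tannery's theorem passes to the sum.\<close>

lemma predual_slice_tendsto:
  fixes \<xi> :: "nat \<Rightarrow> 'i ell2" and W :: "('i \<times> 'j) ell2 \<Rightarrow>\<^sub>L ('i \<times> 'j) ell2"
  assumes W: "W \<in> Bop" and \<xi>: "\<And>n. norm (\<xi> n) = 1"
    and inv: "\<And>u. (\<lambda>n. norm (blinfun_apply W (\<xi> n \<otimes>\<^sub>2 u) - \<xi> n \<otimes>\<^sub>2 u)) \<longlonglongrightarrow> 0"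
    and \<omega>: "\<omega> \<in> predual"
  shows "(\<lambda>n. \<omega> (vec_slice (\<xi> n) (\<xi> n) W)) \<longlonglongrightarrow> \<omega> id_blinfun"
proof -
  from \<omega> obtain a b where a: "summable (\<lambda>n. (norm (a n))\<^sup>2)"
    and b: "summable (\<lambda>n. (norm (b n))\<^sup>2)"
    and \<omega>_eq: "\<omega> = (\<lambda>T. \<Sum>n. cinner (blinfun_apply T (a n)) (b n))"
    by (auto simp: predual_def)
  \<comment> \<open>A summable majorant independent of n, since the product of two norms is at most
    the sum of their squares.\<close>
  define M where "M m = norm W * ((norm (a m))\<^sup>2 + (norm (b m))\<^sup>2)" for m
  have sM: "summable M" unfolding M_def by (intro summable_mult summable_add a b)
  define V where "V n = vec_slice (\<xi> n) (\<xi> n) W" for n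
  have V: "cinner (blinfun_apply (V n) u) v = cinner (blinfun_apply W (\<xi> n \<otimes>\<^sub>2 u)) (\<xi> n \<otimes>\<^sub>2 v)" for n u v
    unfolding V_def by (rule cinner_vec_slice[OF W])
  have nV: "norm (V n) \<le> norm W" for n
    using norm_vec_slice[OF W, of "\<xi> n" "\<xi> n"] by (simp add: V_def \<xi>)
  have lim: "(\<lambda>n. cinner (blinfun_apply (V n) u) v) \<longlonglongrightarrow> cinner u v" for u v
  proof (rule Lim_transform[OF tendsto_const], rule Lim_null_comparison)
    have "cinner u v = cinner (\<xi> n \<otimes>\<^sub>2 u) (\<xi> n \<otimes>\<^sub>2 v)" for n
      by (simp add: cinner_tensor cinner_self_norm \<xi>)
    then have "norm (cinner (blinfun_apply (V n) u) v - cinner u v)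
        \<le> norm (blinfun_apply W (\<xi> n \<otimes>\<^sub>2 u) - \<xi> n \<otimes>\<^sub>2 u) * norm v" for n
      using cinner_bound[of "blinfun_apply W (\<xi> n \<otimes>\<^sub>2 u) - \<xi> n \<otimes>\<^sub>2 u" "\<xi> n \<otimes>\<^sub>2 v"]
      by (simp add: V cinner_diff_left norm_tensor \<xi>)
    then show "\<forall>\<^sub>F n in sequentially. norm (cinner (blinfun_apply (V n) u) v - cinner u v)
        \<le> norm (blinfun_apply W (\<xi> n \<otimes>\<^sub>2 u) - \<xi> n \<otimes>\<^sub>2 u) * norm v"
      by simp
    show "(\<lambda>n. norm (blinfun_apply W (\<xi> n \<otimes>\<^sub>2 u) - \<xi> n \<otimes>\<^sub>2 u) * norm v) \<longlonglongrightarrow> 0"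
      by (rule tendsto_mult_left_zero[OF inv])
  qed
  have bd: "cmod (cinner (blinfun_apply (V n) (a m)) (b m)) \<le> M m" for n m
  proof -
    have "cmod (cinner (blinfun_apply (V n) (a m)) (b m)) \<le> norm (blinfun_apply (V n) (a m)) * norm (b m)"
      by (rule cinner_bound)
    also have "\<dots> \<le> norm W * norm (a m) * norm (b m)"
      by (intro mult_right_mono order_trans[OF norm_blinfun] nV) auto
    also have "\<dots> \<le> M m"
    proof -
      have "norm (a m) * norm (b m) \<le> (norm (a m))\<^sup>2 + (norm (b m))\<^sup>2"
        using sum_squares_bound[of "norm (a m)" "norm (b m)", unfolded mult.assoc]
          mult_nonneg_nonneg[OF norm_ge_zero norm_ge_zero, of "a m" "b m"] by linarith
      then show ?thesis unfolding M_def mult.assoc by (intro mult_left_mono) auto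
    qed
    finally show ?thesis .
  qed
  have "(\<lambda>n. \<Sum>m. cinner (blinfun_apply (V n) (a m)) (b m)) \<longlonglongrightarrow> (\<Sum>m. cinner (a m) (b m))"
    using tannerys_theorem[of "\<lambda>m n. cinner (blinfun_apply (V n) (a m)) (b m)" "\<lambda>m. cinner (a m) (b m)"
        sequentially M, OF lim _ sM] bd by (simp add: always_eventually)
  then show ?thesis by (simp add: \<omega>_eq V_def)
qed

text \<open>
  The counit is the pointwise limit of the vector states of the \<open>\<xi> n\<close>, cut off to \<open>0\<close> at operators
  where these do not converge, so that it is positive on all of \<open>B(\<ell>\<^sup>2)\<close>.
\<close>

lemma coamenable_if_almost_invariant:
  fixes W :: "('i \<times> 'i) ell2 \<Rightarrow>\<^sub>L ('i \<times> 'i) ell2" and \<xi> :: "nat \<Rightarrow> 'i ell2"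
  assumes U: "unitary W" and \<xi>: "\<And>n. norm (\<xi> n) = 1"
    and inv: "\<And>u. (\<lambda>n. norm (blinfun_apply W (\<xi> n \<otimes>\<^sub>2 u) - \<xi> n \<otimes>\<^sub>2 u)) \<longlonglongrightarrow> 0"
  shows "coamenable W"
proof -
  have W: "W \<in> Bop" using U by (simp add: unitary_def)
  define v where "v n T = cinner (blinfun_apply T (\<xi> n)) (\<xi> n)" for n and T :: "'i ell2 \<Rightarrow>\<^sub>L 'i ell2"
  define \<epsilon> where "\<epsilon> T = (if convergent (\<lambda>n. v n T) then lim (\<lambda>n. v n T) else 0)" for T
  have \<epsilon>_eqI: "\<epsilon> T = l" if "(\<lambda>n. v n T) \<longlonglongrightarrow> l" for T l
    using that by (auto simp: \<epsilon>_def convergentI limI)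
  have \<epsilon>_lim: "(\<lambda>n. v n T) \<longlonglongrightarrow> \<epsilon> T" if "convergent (\<lambda>n. v n T)" for T
    using that by (auto simp: \<epsilon>_def convergent_LIMSEQ_iff)
  have v_diff: "v n S - v n T = v n (S - T)" for n S T
    by (simp add: v_def blinfun.diff_left cinner_diff_left)
  have v_bound: "cmod (v n T) \<le> norm T" for n T
    using cinner_bound[of "blinfun_apply T (\<xi> n)" "\<xi> n"] norm_blinfun[of T "\<xi> n"]
    by (simp add: v_def \<xi>)
  have slice: "(\<lambda>n. v n (right_slice \<omega> W)) \<longlonglongrightarrow> \<omega> id_blinfun" if "\<omega> \<in> predual" for \<omega>
    unfolding v_def cinner_right_slice[OF W that] by (rule predual_slice_tendsto[OF W \<xi> inv that])
  \<comment> \<open>The slices are dense in \<open>C0 W\<close> and every \<open>v n\<close> is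
    contractive, so the Cauchy property passes to the closure.\<close>
  have conv: "convergent (\<lambda>n. v n T)" if "T \<in> C0 W" for T
    unfolding Cauchy_convergent_iff[symmetric]
  proof (rule metric_CauchyI)
    fix e :: real assume e: "e > 0"
    then have "e / 4 > 0" by simp
    with that obtain \<omega> where \<omega>: "\<omega> \<in> predual" and d: "dist (right_slice \<omega> W) T < e / 4"
      unfolding C0_def closure_approachable by blast
    from LIMSEQ_imp_Cauchy[OF slice[OF \<omega>]] e
    obtain N where N: "\<And>m n. m \<ge> N \<Longrightarrow> n \<ge> N \<Longrightarrow> dist (v m (right_slice \<omega> W)) (v n (right_slice \<omega> W)) < e / 2"
      unfolding Cauchy_def by (meson half_gt_zero)
    have near: "dist (v n (right_slice \<omega> W)) (v n T) < e / 4" for n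
      using le_less_trans[OF v_bound, of "right_slice \<omega> W - T" "e / 4" n] d by (simp add: dist_norm v_diff)
    show "\<exists>N. \<forall>m\<ge>N. \<forall>n\<ge>N. dist (v m T) (v n T) < e"
    proof (intro exI allI impI)
      fix m n assume "m \<ge> N" "n \<ge> N"
      then show "dist (v m T) (v n T) < e"
        using N[of m n] near[of m] near[of n] dist_triangle[of "v m T" "v n T" "v m (right_slice \<omega> W)"]
          dist_triangle[of "v m (right_slice \<omega> W)" "v n T" "v n (right_slice \<omega> W)"]
        by (simp add: dist_commute)
    qed
  qed
  have C0_Bop: "C0 W \<subseteq> Bop"
    unfolding C0_def by (rule closure_minimal[OF _ closed_Bop]) (auto intro: right_slice_Bop[OF W])
  have bound: "cmod (\<epsilon> a) \<le> norm a" if "a \<in> C0 W" for a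
    by (rule Lim_bounded[OF tendsto_norm[OF \<epsilon>_lim[OF conv[OF that]]]]) (use v_bound in auto)
  \<comment> \<open>A witness for norm 1: the slice of \<open>W\<close> by the vector state of a
    unit vector u lies in the unit ball, and \<epsilon> sends it to <u, u> = 1.\<close>
  define u :: "'i ell2" where "u = ket undefined"
  define a where "a = right_slice (\<lambda>T. cinner (blinfun_apply T u) u) W"
  have a_C0: "a \<in> C0 W"
    unfolding a_def C0_def by (rule subsetD[OF closure_subset]) (use vector_state_predual in blast)
  have \<epsilon>_a: "\<epsilon> a = 1"
    unfolding a_def using \<epsilon>_eqI[OF slice[OF vector_state_predual[of u]]]
    by (simp add: u_def cinner_self_norm)
  have nW: "norm W \<le> 1"
    by (rule norm_blinfun_bound) (simp_all add: norm_unitary[OF U])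
  have norm_a: "norm a \<le> 1"
  proof (rule norm_blinfun_le_form)
    fix x y
    have "cmod (cinner (blinfun_apply a x) y) = cmod (cinner (blinfun_apply (vec_slice x y W) u) u)"
      unfolding a_def cinner_right_slice[OF W vector_state_predual] ..
    also have "\<dots> \<le> norm (blinfun_apply (vec_slice x y W) u)"
      using cinner_bound[of "blinfun_apply (vec_slice x y W) u" u] by (simp add: u_def)
    also have "\<dots> \<le> norm (vec_slice x y W)"
      using norm_blinfun[of "vec_slice x y W" u] by (simp add: u_def)
    also have "\<dots> \<le> norm W * norm x * norm y" by (rule norm_vec_slice[OF W])
    also have "\<dots> \<le> 1 * norm x * norm y" by (intro mult_right_mono nW) auto
    finally show "cmod (cinner (blinfun_apply a x) y) \<le> 1 * norm x * norm y" .
  qed simp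
  have "state_on (C0 W) \<epsilon>"
    unfolding state_on_def
  proof (intro conjI ballI allI)
    show "\<epsilon> (a + b) = \<epsilon> a + \<epsilon> b" if "a \<in> C0 W" "b \<in> C0 W" for a b
      using tendsto_add[OF \<epsilon>_lim[OF conv[OF that(1)]] \<epsilon>_lim[OF conv[OF that(2)]]]
      by (intro \<epsilon>_eqI) (simp add: v_def blinfun.add_left cinner_add_left)
    show "\<epsilon> (scaleC_op c a) = c * \<epsilon> a" if "a \<in> C0 W" for c a
      using tendsto_mult_left[OF \<epsilon>_lim[OF conv[OF that]], of c]
      by (intro \<epsilon>_eqI) (simp add: v_def cinner_scaleC_left)
    show "\<epsilon> (cadj a o\<^sub>L a) \<in> \<real>\<^sub>\<ge>\<^sub>0" if "a \<in> C0 W" for a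
    proof (cases "convergent (\<lambda>n. v n (cadj a o\<^sub>L a))")
      case True
      have "v n (cadj a o\<^sub>L a) = of_real ((norm (blinfun_apply a (\<xi> n)))\<^sup>2)" for n
        using cinner_cadj[of a] that C0_Bop by (auto simp: v_def cinner_self_norm)
      then have "v n (cadj a o\<^sub>L a) \<in> \<real>\<^sub>\<ge>\<^sub>0" for n
        by (simp del: of_real_power)
      then show ?thesis
        by (intro Lim_in_closed_set[OF closed_nonneg_Reals_complex _ _ \<epsilon>_lim[OF True]]) auto
    qed (simp add: \<epsilon>_def)
    show bdd: "bdd_above ((\<lambda>a. cmod (\<epsilon> a)) ` {a \<in> C0 W. norm a \<le> 1})"
      by (rule bdd_aboveI2[where M = 1]) (use bound order_trans in blast)
    show "(SUP a\<in>{a \<in> C0 W. norm a \<le> 1}. cmod (\<epsilon> a)) = 1"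
    proof (rule antisym)
      show "(SUP a\<in>{a \<in> C0 W. norm a \<le> 1}. cmod (\<epsilon> a)) \<le> 1"
        by (rule cSUP_least) (use a_C0 norm_a bound order_trans in blast)+
      show "1 \<le> (SUP a\<in>{a \<in> C0 W. norm a \<le> 1}. cmod (\<epsilon> a))"
        by (rule cSUP_upper2[OF bdd, of a]) (simp_all add: a_C0 norm_a \<epsilon>_a)
    qed
  qed
  moreover have "has_left_slice \<epsilon> W id_blinfun"
    unfolding has_left_slice_def using \<epsilon>_eqI[OF slice] by (auto simp: Bop_def)
  ultimately show ?thesis unfolding coamenable_def by blast
qed

text \<open>For a unit vector z, unitarity turns the squared norm of W z - z into 2 - 2 Re
  <\<open>cadj W\<close> z, z>, which settles basis vectors u. The bound 2 |u| on the defect,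
  uniform in n, extends this to all u by density.\<close>

lemma almost_invariant_if_ket:
  fixes W :: "('i \<times> 'j) ell2 \<Rightarrow>\<^sub>L ('i \<times> 'j) ell2" and \<xi> :: "nat \<Rightarrow> 'i ell2"
  assumes U: "unitary W" and \<xi>: "\<And>n. norm (\<xi> n) = 1"
    and ket: "\<And>k. (\<lambda>n. cinner (blinfun_apply (cadj W) (\<xi> n \<otimes>\<^sub>2 ket k)) (\<xi> n \<otimes>\<^sub>2 ket k)) \<longlonglongrightarrow> 1"
  shows "(\<lambda>n. norm (blinfun_apply W (\<xi> n \<otimes>\<^sub>2 u) - \<xi> n \<otimes>\<^sub>2 u)) \<longlonglongrightarrow> 0"
proof -
  have W: "W \<in> Bop" using U by (simp add: unitary_def)
  define D where "D n u = blinfun_apply W (\<xi> n \<otimes>\<^sub>2 u) - \<xi> n \<otimes>\<^sub>2 u" for n u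
  have D_diff: "D n (u - w) = D n u - D n w" for n u w
    by (simp add: D_def tensor_diff_right blinfun.diff_right)
  have D_sum: "D n (\<Sum>i\<in>F. f i) = (\<Sum>i\<in>F. D n (f i))" for n and f :: "'j \<Rightarrow> 'j ell2" and F
    by (simp add: D_def tensor_sum_right blinfun.sum_right sum_subtractf)
  have D_scale: "norm (D n (c *\<^sub>C u)) = cmod c * norm (D n u)" for n c u
  proof -
    have "D n (c *\<^sub>C u) = c *\<^sub>C D n u"
      using W by (intro ell2_eqI) (simp add: D_def tensor_scaleC_right Bop_def algebra_simps)
    then show ?thesis by simp
  qed
  have D_bound: "norm (D n u) \<le> 2 * norm u" for n u
    using norm_triangle_ineq4[of "blinfun_apply W (\<xi> n \<otimes>\<^sub>2 u)" "\<xi> n \<otimes>\<^sub>2 u"]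
    by (simp add: D_def norm_unitary[OF U] norm_tensor \<xi>)
  have D_ket: "(\<lambda>n. norm (D n (ket k))) \<longlonglongrightarrow> 0" for k
  proof -
    have sq: "(norm (D n (ket k)))\<^sup>2
        = 2 - 2 * Re (cinner (blinfun_apply (cadj W) (\<xi> n \<otimes>\<^sub>2 ket k)) (\<xi> n \<otimes>\<^sub>2 ket k))" for n
    proof -
      define z where "z = \<xi> n \<otimes>\<^sub>2 ket k"
      have z: "norm z = 1" by (simp add: z_def norm_tensor \<xi>)
      have "D n (ket k) = blinfun_apply W (z - blinfun_apply (cadj W) z)"
        by (simp add: D_def z_def blinfun.diff_right unitary_cancel[OF U])
      then have "norm (D n (ket k)) = norm (blinfun_apply (cadj W) z - z)"
        by (simp add: norm_unitary[OF U] norm_minus_commute)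
      then show ?thesis
        by (simp add: norm_diff_power2 norm_unitary[OF U] z flip: z_def)
    qed
    have "(\<lambda>n. (norm (D n (ket k)))\<^sup>2) \<longlonglongrightarrow> 2 - 2 * Re 1"
      unfolding sq by (intro tendsto_intros ket)
    then have "(\<lambda>n. sqrt ((norm (D n (ket k)))\<^sup>2)) \<longlonglongrightarrow> sqrt 0"
      by (intro tendsto_real_sqrt) simp
    then show ?thesis by simp
  qed
  have "(\<lambda>n. norm (D n u)) \<longlonglongrightarrow> 0"
  proof (rule LIMSEQ_I)
    fix e :: real assume e: "e > 0"
    \<comment> \<open>By \<open>D_bound\<close> an error of e/4 in u costs at most e/2 in the
      defect.\<close>
    from ket_expansion[of u, unfolded has_sum_def] have
      "\<forall>\<^sub>F F in finite_subsets_at_top UNIV. dist (\<Sum>i\<in>F. coord u i *\<^sub>C ket i) u < e / 4"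
      by (rule tendstoD) (use e in simp)
    then obtain F where "finite F" and F: "dist (\<Sum>i\<in>F. coord u i *\<^sub>C ket i) u < e / 4"
      unfolding eventually_finite_subsets_at_top by blast
    define w where "w = (\<Sum>i\<in>F. coord u i *\<^sub>C ket i)"
    have "norm (D n w) \<le> (\<Sum>i\<in>F. cmod (coord u i) * norm (D n (ket i)))" for n
      unfolding w_def D_sum D_scale[symmetric] by (rule norm_sum)
    moreover have "(\<lambda>n. \<Sum>i\<in>F. cmod (coord u i) * norm (D n (ket i))) \<longlonglongrightarrow> (\<Sum>i\<in>F. cmod (coord u i) * 0)"
      by (intro tendsto_intros D_ket)
    ultimately have "(\<lambda>n. norm (D n w)) \<longlonglongrightarrow> 0"
      by (intro Lim_null_comparison[of "\<lambda>n. norm (D n w)", OF always_eventually]) simp_all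
    from LIMSEQ_D[OF this, of "e / 2"] e obtain N where N: "\<And>n. n \<ge> N \<Longrightarrow> norm (D n w) < e / 2"
      by auto
    have "norm (D n u) < e" if "n \<ge> N" for n
    proof -
      have "norm (D n u) \<le> norm (D n w) + norm (D n (u - w))"
        using norm_triangle_ineq[of "D n w" "D n (u - w)"] by (simp add: D_diff)
      also have "norm (D n (u - w)) \<le> 2 * norm (u - w)" by (rule D_bound)
      also have "norm (u - w) < e / 4" using F by (simp add: w_def dist_norm norm_minus_commute)
      finally show ?thesis using N[OF that] by simp
    qed
    then show "\<exists>N. \<forall>n\<ge>N. norm (norm (D n u) - 0) < e" by auto
  qed
  then show ?thesis by (simp only: D_def)
qed

section \<open>Almost invariant vectors for the extended quantum \<open>SU(1,1)\<close> group\<close>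

text \<open>The Folner property of intervals in the integers: the line j = i + d meets the square
  over n, ..., 2n in n + 1 - |d| points once n >= |d|. On it both indices are at least n, so the
  products are close to 1.\<close>

lemma banded_average_tendsto:
  fixes \<alpha> \<beta> :: "nat \<Rightarrow> real" and d :: int
  assumes \<alpha>: "\<alpha> \<longlonglongrightarrow> 1" and \<beta>: "\<beta> \<longlonglongrightarrow> 1"
  shows "(\<lambda>n. (\<Sum>i=n..2*n. \<Sum>j=n..2*n. if int j = int i + d then \<alpha> i * \<beta> j else 0) / (real n + 1)) \<longlonglongrightarrow> 1"
proof (rule LIMSEQ_I)
  fix e :: real assume e: "e > 0"
  have p: "(\<lambda>i. \<alpha> i * \<beta> (nat (int i + d))) \<longlonglongrightarrow> 1"
  proof -
    have "filterlim (\<lambda>i. nat (int i + d)) sequentially sequentially"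
      unfolding filterlim_at_top eventually_sequentially
    proof
      fix Z :: nat
      show "\<exists>N. \<forall>n\<ge>N. Z \<le> nat (int n + d)"
        by (intro exI[of _ "Z + nat \<bar>d\<bar>"]) auto
    qed
    from tendsto_mult[OF \<alpha> filterlim_compose[OF \<beta> this]] show ?thesis by simp
  qed
  from LIMSEQ_D[OF this, of "e / 2"] e
  obtain N where N: "\<And>i. i \<ge> N \<Longrightarrow> \<bar>\<alpha> i * \<beta> (nat (int i + d)) - 1\<bar> < e / 2" by auto
  have "(\<lambda>n. \<bar>of_int d\<bar> / (real n + 1)) \<longlonglongrightarrow> 0" by real_asymp
  from LIMSEQ_D[OF this, of "e / 2"] e
  obtain N' where N': "\<And>n. n \<ge> N' \<Longrightarrow> \<bar>of_int d\<bar> / (real n + 1) < e / 2" by auto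
  show "\<exists>N. \<forall>n\<ge>N. norm ((\<Sum>i=n..2*n. \<Sum>j=n..2*n. if int j = int i + d then \<alpha> i * \<beta> j else 0)
      / (real n + 1) - 1) < e"
  proof (intro exI allI impI)
    fix n assume n: "n \<ge> max N (max N' (nat \<bar>d\<bar>))"
    \<comment> \<open>The rows i whose partner i + d stays in the window; all other rows
      vanish.\<close>
    define B where "B = {i. n \<le> i \<and> i \<le> 2 * n \<and> int n \<le> int i + d \<and> int i + d \<le> 2 * int n}"
    define S where "S = (\<Sum>i=n..2*n. \<Sum>j=n..2*n. if int j = int i + d then \<alpha> i * \<beta> j else 0)"
    \<comment> \<open>Ensures that \<open>nat\<close> does not truncate the cardinality
      below.\<close>
    have dn: "\<bar>d\<bar> \<le> int n" using n by linarith
    have "int ` B = {max (int n) (int n - d)..min (2 * int n) (2 * int n - d)}" (is "_ = ?I")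
    proof (rule set_eqI)
      show "x \<in> int ` B \<longleftrightarrow> x \<in> ?I" for x
        by (cases x rule: int_cases2) (auto simp: B_def image_iff)
    qed
    then have "card B = card ?I" by (metis card_image inj_on_of_nat)
    also have "\<dots> = nat (int n + 1 - \<bar>d\<bar>)" by (simp add: max_def min_def algebra_simps)
    finally have "int (card B) = int n + 1 - \<bar>d\<bar>" using dn by simp
    then have "real_of_int (int (card B)) = real_of_int (int n + 1 - \<bar>d\<bar>)" by (rule arg_cong)
    then have cB: "real (card B) = real n + 1 - \<bar>of_int d\<bar>" by simp
    have row: "(\<Sum>j=n..2*n. if int j = int i + d then \<alpha> i * \<beta> j else 0)
       = (if i \<in> B then \<alpha> i * \<beta> (nat (int i + d)) else 0)" if "i \<in> {n..2*n}" for i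
    proof -
      have "(\<Sum>j=n..2*n. if int j = int i + d then \<alpha> i * \<beta> j else 0)
        = (\<Sum>j=n..2*n. if j = nat (int i + d) \<and> i \<in> B then \<alpha> i * \<beta> (nat (int i + d)) else 0)"
        using that by (intro sum.cong) (auto simp: B_def)
      then show ?thesis
        using that by (cases "i \<in> B") (auto simp: B_def)
    qed
    have "S = (\<Sum>i=n..2*n. if i \<in> B then \<alpha> i * \<beta> (nat (int i + d)) else 0)"
      unfolding S_def by (intro sum.cong refl row)
    also have "\<dots> = (\<Sum>i\<in>B. \<alpha> i * \<beta> (nat (int i + d)))"
      by (intro sum.mono_neutral_cong_right) (auto simp: B_def)
    finally have "S - real (card B) = (\<Sum>i\<in>B. \<alpha> i * \<beta> (nat (int i + d)) - 1)"
      by (simp add: sum_subtractf)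
    also have "\<bar>\<dots>\<bar> \<le> (\<Sum>i\<in>B. e / 2)"
      by (intro order_trans[OF sum_abs] sum_mono less_imp_le[OF N]) (use n in \<open>auto simp: B_def\<close>)
    also have "\<dots> \<le> (real n + 1) * (e / 2)"
      using e by (simp add: cB)
    finally have "\<bar>S - (real n + 1)\<bar> \<le> (real n + 1) * (e / 2) + \<bar>of_int d\<bar>"
      unfolding cB by linarith
    then have "\<bar>S - (real n + 1)\<bar> / (real n + 1) \<le> ((real n + 1) * (e / 2) + \<bar>of_int d\<bar>) / (real n + 1)"
      by (rule divide_right_mono) simp
    also have "\<dots> = e / 2 + \<bar>of_int d\<bar> / (real n + 1)"
    proof -
      have "real n + 1 \<noteq> 0" by linarith
      then show ?thesis
        by (simp only: add_divide_distrib nonzero_mult_div_cancel_left not_False_eq_True)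
    qed
    also have "\<dots> < e" using N'[of n] n by linarith
    also have "\<bar>S - (real n + 1)\<bar> / (real n + 1) = \<bar>S / (real n + 1) - 1\<bar>"
    proof -
      have "S / (real n + 1) - 1 = (S - (real n + 1)) / (real n + 1)"
        by (simp add: diff_divide_distrib)
      then show ?thesis by (simp only: abs_divide abs_of_nonneg[of "real n + 1"] of_nat_0_le_iff
            add_nonneg_nonneg zero_le_one)
    qed
    finally have "\<bar>S / (real n + 1) - 1\<bar> < e" .
    then show "norm ((\<Sum>i=n..2*n. \<Sum>j=n..2*n. if int j = int i + d then \<alpha> i * \<beta> j else 0)
      / (real n + 1) - 1) < e" by (simp add: S_def)
  qed
qed

text \<open>Continuity of coordinates allows the series for \<open>cadj W\<close> to be read
  coordinatewise.\<close>

lemma bounded_linear_coord: "bounded_linear (\<lambda>x. coord x k)"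
proof (rule bounded_linear_intro[where K = 1])
  show "norm (coord x k) \<le> norm x * 1" for x
    using cinner_bound[of x "ket k"] by (simp add: cinner_ket_right)
qed (simp_all add: scaleR_conv_of_real)

lemma Iq_point_abs:
  assumes "0 < q"
  obtains k where "\<bar>Iq_point q b\<bar> = q powi k"
proof (cases b)
  case (PosPt k)
  then show ?thesis using assms that[of k] by simp
next
  case (NegPt n)
  then show ?thesis using assms that[of "int (Suc n)"] by (simp del: power_Suc of_nat_Suc)
qed

text \<open>Prescribing the same second leg on both sides leaves at most one term of the defining
  series, so that \<open>cadj W\<close> is compressed to a weighted shift of the exponent i.\<close>

lemma cinner_cadj_SUq11_ext:
  fixes q :: real and i j :: nat and m m2 :: int and s b c :: iq
  assumes q: "0 < q" "q < 1" and W: "SUq11_ext_unitary q W"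
  defines "e \<equiv> \<lambda>i::nat. ket (m, PosPt (- int i), s)"
    and "p \<equiv> Iq_point q b" and "t \<equiv> Iq_point q c"
  shows "cinner (blinfun_apply (cadj W) (e i \<otimes>\<^sub>2 ket (m2, b, c))) (e j \<otimes>\<^sub>2 ket (m2, b, c))
    = complex_of_real (if int j = int i + (m2 + chi q t - chi q p)
        then a_coeff q t (q powi (- int i)) t * a_coeff q p (q powi (- int j)) p else 0)"
proof -
  note bij = bij_betw_Iq_point[OF q]
  have inj: "inj (Iq_point q)" using bij by (simp add: bij_betw_def)
  have inv_iff: "inv (Iq_point q) y = b' \<longleftrightarrow> y = Iq_point q b'" if "y \<in> Iq q" for y b'
    using that inv_f_f[OF inj] f_inv_into_f[of y "Iq_point q" UNIV] bij by (auto simp: bij_betw_def)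
  have range: "Iq_point q b' \<in> Iq q" for b'
    using bij by (auto simp: bij_betw_def)
  have f: "f_basis q m' (Iq_point q b') (Iq_point q c') = ket (m', b', c')" for m' b' c'
    by (simp add: f_basis_def inv_f_f[OF inj])
  define x y' where "x = q powi (- int i)" and "y' = q powi (- int j)"
  have x: "x > 0" and y': "y' > 0" using q by (simp_all add: x_def y'_def)
  have xI: "x = Iq_point q (PosPt (- int i))" and yI: "y' = Iq_point q (PosPt (- int j))"
    by (simp_all add: x_def y'_def)
  have mem_Iq: "y' \<in> Iq q" "p \<in> Iq q" "t \<in> Iq q"
    unfolding yI p_def t_def by (rule range)+
  define K where "K = ((m, PosPt (- int j), s), (m2, b, c))"
  obtain kt where kt: "\<bar>t\<bar> = q powi kt" unfolding t_def by (rule Iq_point_abs[OF q(1)])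
  obtain kp where kp: "\<bar>p\<bar> = q powi kp" unfolding p_def by (rule Iq_point_abs[OF q(1)])
  have chi: "chi q t = kt" "chi q p = kp" using chi_eq(1)[OF q] kt kp by auto
  have q0: "q \<noteq> 0" and t0: "t \<noteq> 0" and p0: "p \<noteq> 0" using q kt kp by auto
  let ?g = "\<lambda>(y, z). (\<bar>t / y\<bar> * a_coeff q t x y * a_coeff q p z (w_pt q x m2 p t y z)) *\<^sub>R
            (f_basis q (m + m2 - chi q (x * p / (t * z))) z (Iq_point q s) \<otimes>\<^sub>2
             f_basis q (chi q (x * p / (t * z))) (w_pt q x m2 p t y z) y)"
  let ?S = "{(y, z). y \<in> Iq q \<and> z \<in> Iq q \<and> w_pt q x m2 p t y z \<in> Iq q}"
  have "(?g has_sum blinfun_apply (cadj W) (f_basis q m x (Iq_point q s) \<otimes>\<^sub>2 f_basis q m2 p t)) ?S"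
    using W range unfolding SUq11_ext_unitary_def xI p_def t_def by blast
  then have "(?g has_sum blinfun_apply (cadj W) (e i \<otimes>\<^sub>2 ket (m2, b, c))) ?S"
    by (simp only: xI p_def t_def f e_def)
  from has_sum_bounded_linear[OF bounded_linear_coord this, of K]
  have "((\<lambda>yz. coord (?g yz) K) has_sum coord (blinfun_apply (cadj W) (e i \<otimes>\<^sub>2 ket (m2, b, c))) K) ?S"
    by (simp only: o_def)
  \<comment> \<open>A term meets the basis vector \<open>K\<close> only if z = q^(-j), y = t and w =
    p, so the index set shrinks to one point or none.\<close>
  moreover have "((\<lambda>yz. coord (?g yz) K) has_sum l) ?S \<longleftrightarrow>
      ((\<lambda>yz. coord (?g yz) K) has_sum l) (if w_pt q x m2 p t t y' = p then {(t, y')} else {})" for l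
  proof (rule has_sum_cong_neutral)
    show "coord (?g yz) K = 0" if "yz \<in> ?S - (if w_pt q x m2 p t t y' = p then {(t, y')} else {})" for yz
    proof (rule ccontr)
      obtain y z where yz: "yz = (y, z)" by (cases yz)
      assume "coord (?g yz) K \<noteq> 0"
      then have eqs: "inv (Iq_point q) z = PosPt (- int j)" "inv (Iq_point q) (w_pt q x m2 p t y z) = b"
          "inv (Iq_point q) y = c"
        by (auto simp: yz K_def f_basis_def tensor_ket coord_ket split: if_splits)
      have mem: "z \<in> Iq q" "w_pt q x m2 p t y z \<in> Iq q" "y \<in> Iq q"
        using that yz by auto
      have "z = y'" "w_pt q x m2 p t y z = p" "y = t"
        using eqs unfolding yI p_def t_def inv_iff[OF mem(1)] inv_iff[OF mem(2)[unfolded p_def t_def]] inv_iff[OF mem(3)] .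
      then show False using that yz by auto
    qed
    show "coord (?g yz) K = 0" if "yz \<in> (if w_pt q x m2 p t t y' = p then {(t, y')} else {}) - ?S" for yz
      using that mem_Iq by (auto split: if_splits)
  qed simp
  ultimately have 1: "coord (blinfun_apply (cadj W) (e i \<otimes>\<^sub>2 ket (m2, b, c))) K
      = (\<Sum>yz\<in>(if w_pt q x m2 p t t y' = p then {(t, y')} else {}). coord (?g yz) K)"
    by (auto split: if_splits dest: has_sum_unique[OF _ has_sum_finite])
  have w_abs: "\<bar>w_pt q x m2 p t t y'\<bar> = q powi (kt - int j + int i + m2)"
  proof -
    have "\<bar>w_pt q x m2 p t t y'\<bar> = \<bar>t\<bar> * y' / x * q powi m2"
      using x y' t0 p0 q by (simp add: w_pt_def abs_mult abs_sgn_eq)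
    also have "\<dots> = q powi (kt + (- int j) - (- int i) + m2)"
      unfolding kt x_def y'_def by (simp only: power_int_add power_int_diff q0 simp_thms)
    finally show ?thesis by simp
  qed
  \<comment> \<open>The sign of w is sgn(p t) sgn(t) = sgn(p) in any case, so equality with p only
    compares exponents.\<close>
  have w_iff: "w_pt q x m2 p t t y' = p \<longleftrightarrow> int j = int i + (m2 + kt - kp)"
  proof
    assume "w_pt q x m2 p t t y' = p"
    then have "chi q p = kt - int j + int i + m2" by (intro chi_eq(1)[OF q]) (simp add: w_abs[symmetric])
    then show "int j = int i + (m2 + kt - kp)" by (simp add: chi)
  next
    assume "int j = int i + (m2 + kt - kp)"
    then have "kt - int j + int i + m2 = kp" by simp
    then have "\<bar>w_pt q x m2 p t t y'\<bar> = \<bar>p\<bar>" using w_abs kp by simp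
    moreover have "sgn (w_pt q x m2 p t t y') = sgn p"
      using x y' t0 q by (simp add: w_pt_def sgn_mult sgn_divide)
    ultimately show "w_pt q x m2 p t t y' = p" by (metis mult_sgn_abs)
  qed
  have "coord (?g (t, y')) K = complex_of_real (a_coeff q t x t * a_coeff q p y' p)"
    if w: "w_pt q x m2 p t t y' = p"
  proof -
    \<comment> \<open>The same relation makes the chi-index equal to m2, so both integer indices
      return to their initial values.\<close>
    have m2: "m2 = - int i + kp - (kt + (- int j))" using w unfolding w_iff by simp
    have "\<bar>x * p / (t * y')\<bar> = x * \<bar>p\<bar> / (\<bar>t\<bar> * y')"
      using x y' by (simp add: abs_mult)
    also have "\<dots> = q powi m2"
      unfolding m2 kt kp x_def y'_def by (simp only: power_int_add power_int_diff q0 simp_thms)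
    finally have "chi q (x * p / (t * y')) = m2" by (rule chi_eq(1)[OF q])
    then show ?thesis
      using t0 by (simp add: w) (simp add: yI p_def t_def f tensor_ket coord_ket K_def del: Iq_point.simps)
  qed
  then have "coord (blinfun_apply (cadj W) (e i \<otimes>\<^sub>2 ket (m2, b, c))) K
    = complex_of_real (if int j = int i + (m2 + chi q t - chi q p)
        then a_coeff q t x t * a_coeff q p y' p else 0)"
    unfolding 1 chi w_iff[symmetric] by simp
  then show ?thesis
    by (simp add: e_def tensor_ket cinner_ket_right K_def x_def y'_def)
qed

theorem theoremA:
  fixes q :: real
    and W :: "(su_ix \<times> su_ix) ell2 \<Rightarrow>\<^sub>L (su_ix \<times> su_ix) ell2"
  assumes "0 < q" and "q < 1"
    and "SUq11_ext_unitary q W"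
  shows "coamenable W"
proof -
  note q = assms(1,2) and W = assms(3)
  have U: "unitary W" using W by (simp add: SUq11_ext_unitary_def)
  \<comment> \<open>Any fixed integer index and third entry would serve; here they are 0 and 1 =
    q^0.\<close>
  define e :: "nat \<Rightarrow> su_ix ell2" where "e = (\<lambda>i. ket (0, PosPt (- int i), PosPt 0))"
  \<comment> \<open>The window n, ..., 2n holds n + 1 orthonormal vectors.\<close>
  define r where "r n = complex_of_real (1 / sqrt (real n + 1))" for n
  have r2: "r n * cnj (r n) = 1 / (real n + 1)" for n
    by (simp add: r_def flip: of_real_mult)
  define \<xi> where "\<xi> n = r n *\<^sub>C (\<Sum>i=n..2*n. e i)" for n
  have \<xi>: "norm (\<xi> n) = 1" for n
  proof -
    have "cinner (\<xi> n) (\<xi> n) = r n * cnj (r n) * (\<Sum>i=n..2*n. \<Sum>j=n..2*n. cinner (e i) (e j))"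
      unfolding \<xi>_def cinner_scaleC_left cinner_scaleC_right cinner_sum_left mult.assoc
      unfolding cinner_sum_right by (simp only: mult_ac)
    also have "(\<Sum>i=n..2*n. \<Sum>j=n..2*n. cinner (e i) (e j)) = (\<Sum>i=n..2*n. 1)"
      by (intro sum.cong) (auto simp: e_def cinner_ket_right coord_ket)
    also have "r n * cnj (r n) * \<dots> = 1"
      unfolding r2 using of_nat_neq_0[of n, where 'a = complex] by (simp add: add.commute)
    finally have "(norm (\<xi> n))\<^sup>2 = 1"
      unfolding cinner_self_norm by (simp only: of_real_eq_1_iff)
    then show ?thesis by (metis norm_ge_zero power2_eq_1_iff le_minus_one_simps(3))
  qed
  show ?thesis
  proof (rule coamenable_if_almost_invariant[OF U \<xi>], rule almost_invariant_if_ket[OF U \<xi>])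
    fix k :: su_ix
    obtain m b c where k: "k = (m, b, c)" by (cases k)
    define p t where "p = Iq_point q b" and "t = Iq_point q c"
    have pt: "p \<in> Iq q" "t \<in> Iq q"
      using bij_betw_Iq_point[OF q] by (auto simp: bij_betw_def p_def t_def)
    define \<alpha> \<beta> where "\<alpha> i = a_coeff q t (q powi (- int i)) t" and "\<beta> i = a_coeff q p (q powi (- int i)) p" for i
    have Wadj: "blinfun_apply (cadj W) (z *\<^sub>C x) = z *\<^sub>C blinfun_apply (cadj W) x" for z x
      using cadj_Bop[of W] U by (simp add: unitary_def Bop_def)
    \<comment> \<open>The shift depends on k alone, not on i, j or n, so the matrix coefficient at
      \<open>\<xi> n\<close> is a band average.\<close>
    have coef: "cinner (blinfun_apply (cadj W) (e i \<otimes>\<^sub>2 ket k)) (e j \<otimes>\<^sub>2 ket k)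
      = complex_of_real (if int j = int i + (m + chi q t - chi q p) then \<alpha> i * \<beta> j else 0)" for i j
      unfolding e_def k \<alpha>_def \<beta>_def p_def t_def by (rule cinner_cadj_SUq11_ext[OF q W])
    have "cinner (blinfun_apply (cadj W) (\<xi> n \<otimes>\<^sub>2 ket k)) (\<xi> n \<otimes>\<^sub>2 ket k)
      = complex_of_real ((\<Sum>i=n..2*n. \<Sum>j=n..2*n.
          if int j = int i + (m + chi q t - chi q p) then \<alpha> i * \<beta> j else 0) / (real n + 1))" for n
    proof -
      have "cinner (blinfun_apply (cadj W) (\<xi> n \<otimes>\<^sub>2 ket k)) (\<xi> n \<otimes>\<^sub>2 ket k)
        = r n * cnj (r n) * (\<Sum>i=n..2*n. \<Sum>j=n..2*n.
            cinner (blinfun_apply (cadj W) (e i \<otimes>\<^sub>2 ket k)) (e j \<otimes>\<^sub>2 ket k))"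
        unfolding \<xi>_def tensor_scaleC_left tensor_sum_left Wadj blinfun.sum_right
          cinner_scaleC_left cinner_scaleC_right cinner_sum_left mult.assoc
        unfolding cinner_sum_right by (simp only: mult_ac)
      then show ?thesis unfolding coef r2 by simp
    qed
    moreover have "(\<lambda>n. complex_of_real ((\<Sum>i=n..2*n. \<Sum>j=n..2*n.
          if int j = int i + (m + chi q t - chi q p) then \<alpha> i * \<beta> j else 0) / (real n + 1))) \<longlonglongrightarrow> of_real 1"
      by (intro tendsto_of_real banded_average_tendsto)
        (simp_all only: \<alpha>_def \<beta>_def a_coeff_tendsto_1[OF q] pt)
    ultimately show "(\<lambda>n. cinner (blinfun_apply (cadj W) (\<xi> n \<otimes>\<^sub>2 ket k)) (\<xi> n \<otimes>\<^sub>2 ket k)) \<longlonglongrightarrow> 1"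
      by (simp only: of_real_1)
  qed
qed

end
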